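(* For every connected graph $G$ the following are equivalent: (i) $G$ is normally traceable; (ii) $G$ has a normal rank.
   Context: A rooted tree $T\subseteq G$ is normal in $G$ if the endvertices of every $T$-path in $G$ are comparable in the tree-order of $T$. A set $U\subseteq V(G)$ is normally spanned in $G$ if it is contained in some tree $T\subseteq G$ normal in $G$. A connected graph $G$ is normally traceable if it has a tree-decomposition $(T,(V_t)_{t\in T})$ whose decomposition tree $T$ contains no ray and every part $V_t$ is normally spanned in $G$. For a connected graph $G$, let $\mathcal I(G)$ be the class of vertex sets normally spanned in $G$ (this is an ideal: contains $\emptyset$, closed under finite unions and subsets). The normal rank of a subgraph $H\subseteq G$ in $G$ is defined by transfinite recursion: $H$ has normal rank $0$ in $G$ if $V(H)\in\mathcal I(G)$; for an ordinal $\alpha>0$, $H$ has normal rank $\alpha$ in $G$ if it does not have normal rank less than $\alpha$ in $G$ and there is a vertex set $X\in\mathcal I(G)$ such that every component of $H-X$ has normal rank less than $\alpha$ in $G$. The graph $G$ has normal rank $\alpha$ if it has normal rank $\alpha$ in $G$; $G$ "has a normal rank" if it has normal rank $\alpha$ for some ordinal $\alpha$. *)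

theory Defs
  imports Main
begin

unbundle cardinal_syntax

section \<open>Graphs\<close>

text \<open>Graphs are simple and undirected, of arbitrary cardinality.\<close>

record 'v ugraph =
  verts :: "'v set"
  edges :: "'v set set"

definition ugraph :: "'v ugraph \<Rightarrow> bool" where
  "ugraph G \<longleftrightarrow> (\<forall>e\<in>edges G. \<exists>u\<in>verts G. \<exists>v\<in>verts G. u \<noteq> v \<and> e = {u, v})"

definition adj :: "'v ugraph \<Rightarrow> 'v \<Rightarrow> 'v \<Rightarrow> bool" where
  "adj G u v \<longleftrightarrow> {u, v} \<in> edges G"

definition subgraph_of :: "'v ugraph \<Rightarrow> 'v ugraph \<Rightarrow> bool" where
  "subgraph_of H G \<longleftrightarrow> ugraph H \<and> ugraph G \<and> verts H \<subseteq> verts G \<and> edges H \<subseteq> edges G"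

definition delete_verts :: "'v ugraph \<Rightarrow> 'v set \<Rightarrow> 'v ugraph" where
  "delete_verts G X = \<lparr>verts = verts G - X, edges = {e \<in> edges G. e \<inter> X = {}}\<rparr>"

text \<open>A finite path is the list of its vertices in order; singleton lists are trivial paths.\<close>

definition upath :: "'v ugraph \<Rightarrow> 'v list \<Rightarrow> bool" where
  "upath G p \<longleftrightarrow> p \<noteq> [] \<and> set p \<subseteq> verts G \<and> distinct p \<and> successively (adj G) p"

definition upath_between :: "'v ugraph \<Rightarrow> 'v \<Rightarrow> 'v list \<Rightarrow> 'v \<Rightarrow> bool" where
  "upath_between G u p v \<longleftrightarrow> upath G p \<and> hd p = u \<and> last p = v"

text \<open>Connected graphs, and hence trees and components, are non-empty.\<close>

definition connected_ugraph :: "'v ugraph \<Rightarrow> bool" where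
  "connected_ugraph G \<longleftrightarrow> ugraph G \<and> verts G \<noteq> {} \<and>
     (\<forall>u\<in>verts G. \<forall>v\<in>verts G. \<exists>p. upath_between G u p v)"

definition ucomponents :: "'v ugraph \<Rightarrow> 'v ugraph set" where
  "ucomponents G = {C. subgraph_of C G \<and> connected_ugraph C \<and>
     (\<forall>D. subgraph_of D G \<and> connected_ugraph D \<and> subgraph_of C D \<longrightarrow> D = C)}"

definition ucycle :: "'v ugraph \<Rightarrow> 'v list \<Rightarrow> bool" where
  "ucycle G p \<longleftrightarrow> upath G p \<and> 3 \<le> length p \<and> adj G (last p) (hd p)"

definition utree :: "'v ugraph \<Rightarrow> bool" where
  "utree T \<longleftrightarrow> connected_ugraph T \<and> (\<nexists>p. ucycle T p)"

definition ray :: "'v ugraph \<Rightarrow> (nat \<Rightarrow> 'v) \<Rightarrow> bool" where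
  "ray G f \<longleftrightarrow> inj f \<and> range f \<subseteq> verts G \<and> (\<forall>n. adj G (f n) (f (Suc n)))"


section \<open>Normal trees\<close>

definition tree_le :: "'v ugraph \<Rightarrow> 'v \<Rightarrow> 'v \<Rightarrow> 'v \<Rightarrow> bool" where
  "tree_le T r x y \<longleftrightarrow> (\<exists>p. upath_between T r p y \<and> x \<in> set p)"

text \<open>
  A \<open>T\<close>-path is a non-trivial path meeting \<open>T\<close> exactly in its endvertices.  Its inner vertices
  avoid \<open>T\<close>, so only for a path consisting of one edge must it be required that no edge
  lies in \<open>T\<close>.
\<close>

definition T_path :: "'v ugraph \<Rightarrow> 'v ugraph \<Rightarrow> 'v list \<Rightarrow> bool" where
  "T_path G T p \<longleftrightarrow> upath G p \<and> 2 \<le> length p \<and> set p \<inter> verts T = {hd p, last p} \<and>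
     (length p = 2 \<longrightarrow> \<not> adj T (hd p) (last p))"

definition normal_tree :: "'v ugraph \<Rightarrow> 'v ugraph \<Rightarrow> 'v \<Rightarrow> bool" where
  "normal_tree G T r \<longleftrightarrow> utree T \<and> r \<in> verts T \<and> subgraph_of T G \<and>
     (\<forall>p. T_path G T p \<longrightarrow> tree_le T r (hd p) (last p) \<or> tree_le T r (last p) (hd p))"

definition normally_spanned :: "'v ugraph \<Rightarrow> 'v set \<Rightarrow> bool" where
  "normally_spanned G U \<longleftrightarrow> U \<subseteq> verts G \<and> (\<exists>T r. normal_tree G T r \<and> U \<subseteq> verts T)"


section \<open>Normally traceable graphs\<close>

definition tree_decomposition :: "'v ugraph \<Rightarrow> 't ugraph \<Rightarrow> ('t \<Rightarrow> 'v set) \<Rightarrow> bool" where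
  "tree_decomposition G T P \<longleftrightarrow> utree T \<and>
     (\<Union>t\<in>verts T. P t) = verts G \<and>
     (\<forall>e\<in>edges G. \<exists>t\<in>verts T. e \<subseteq> P t) \<and>
     (\<forall>t1 p t3. upath_between T t1 p t3 \<longrightarrow> (\<forall>t2\<in>set p. P t1 \<inter> P t3 \<subseteq> P t2))"

text \<open>
  HOL cannot quantify over types inside a formula, so the type \<open>'t\<close> that supplies the nodes of
  decomposition trees is a parameter.
\<close>

definition normally_traceable :: "'t itself \<Rightarrow> 'v ugraph \<Rightarrow> bool" where
  "normally_traceable _ G \<longleftrightarrow> connected_ugraph G \<and>
     (\<exists>(T :: 't ugraph) P. tree_decomposition G T P \<and> (\<nexists>f. ray T f) \<and>
        (\<forall>t\<in>verts T. normally_spanned G (P t)))"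


section \<open>Normal rank\<close>

text \<open>
  Ordinals are represented by well-orders on subsets of a type \<open>'o\<close>, compared by \<open><o\<close>;
  isomorphic well-orders represent the same ordinal, and the empty relation represents \<open>0\<close>.
  Every ordinal below a represented one is itself represented (by an initial segment).
  \<open>has_normal_rank_in G \<alpha> H\<close> reads: the subgraph \<open>H\<close> has normal rank \<open>\<alpha>\<close> in \<open>G\<close>.
\<close>

function has_normal_rank_in :: "'v ugraph \<Rightarrow> 'o rel \<Rightarrow> 'v ugraph \<Rightarrow> bool" where
  "has_normal_rank_in G \<alpha> H \<longleftrightarrow> Well_order \<alpha> \<and>
     (if \<alpha> = {} then normally_spanned G (verts H)
      else \<not> (\<exists>\<beta>\<in>{\<beta>. \<beta> <o \<alpha>}. has_normal_rank_in G \<beta> H) \<and>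
        (\<exists>X. normally_spanned G X \<and>
           (\<forall>C\<in>ucomponents (delete_verts H X). \<exists>\<beta>\<in>{\<beta>. \<beta> <o \<alpha>}. has_normal_rank_in G \<beta> C)))"
  by pat_completeness auto
termination
  by (relation "inv_image ordLess (\<lambda>(G, \<alpha>, H). \<alpha>)") (auto intro: wf_ordLess)

declare has_normal_rank_in.simps [simp del]

definition has_normal_rank :: "'o itself \<Rightarrow> 'v ugraph \<Rightarrow> bool" where
  "has_normal_rank _ G \<longleftrightarrow> (\<exists>\<alpha> :: 'o rel. has_normal_rank_in G \<alpha> G)"

unbundle no cardinal_syntax

end

theory Submission
  imports Defs "HOL-Library.Sublist"
begin

text \<open>
  Normally spanned sets form an ideal: the levels of a normal tree are dispersed (every ray is
  separated from them by a finite set), and, starting from a single vertex, normal trees can be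
  extended to contain an increasing sequence of dispersed sets one after the other, each tree being
  an initial part of the next; Zorn's lemma gives each single extension.

  Given a normal rank, delete from every vertex set a normally spanned set witnessing its rank and
  pass to the components.  Ranks decrease, so iterating this gives a rayless tree of vertex sets,
  and the parts of the tree-decomposition are the finite unions of the sets deleted along the root
  paths.  Conversely, the rootward order of a rayless decomposition tree is well-founded, and
  deleting the part at a node \<open>t\<close> from a vertex set contained in the parts above \<open>t\<close> leaves
  components each contained in the parts above a single child of \<open>t\<close>.
\<close>

text \<open>HOL offers only fixed types for nodes and ordinals, which is why both embeddings start
  from \<open>'v set\<close>: the nodes of the tree built from a rank are vertex sets, and the ranks
  obtained from a decomposition are bounded by initial segments of a well-order of
  \<open>'v set\<close>, whatever the node type is. The union of two normal trees need not be
  normal, so a tree containing both vertex sets is grown anew. Absorbing one more vertex requires a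
  highest tree vertex to attach to. It exists if the set being absorbed is dispersed and every tree
  vertex lies below some vertex of that set; otherwise the candidates could span a ray. A whole
  normally spanned set need not be dispersed (it may be the vertex set of a ray), hence the detour
  over levels. Parts must accumulate along root paths because adjacent vertices may be deleted at
  different nodes. Root paths are finite, so closure under binary unions is enough.\<close>

lemma adj_sym: "adj G x y \<Longrightarrow> adj G y x"
  by (simp add: adj_def insert_commute)

lemma adj_vertsD:
  assumes "ugraph G" "adj G x y"
  shows "x \<in> verts G" "y \<in> verts G" "x \<noteq> y"
  using assms unfolding ugraph_def adj_def by (auto simp: doubleton_eq_iff)

lemma upath_snoc:
  "upath G (p @ [x]) \<longleftrightarrow>
     x \<in> verts G \<and> (p = [] \<or> upath G p \<and> x \<notin> set p \<and> adj G (last p) x)"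
  by (cases "p = []") (auto simp: upath_def successively_append_iff)

lemma upath_appendD1: "upath G (p @ q) \<Longrightarrow> p \<noteq> [] \<Longrightarrow> upath G p"
  by (auto simp: upath_def successively_append_iff)

lemma upath_appendD2: "upath G (p @ q) \<Longrightarrow> q \<noteq> [] \<Longrightarrow> upath G q"
  by (auto simp: upath_def successively_append_iff)

lemma successively_adj_rev: "successively (adj G) (rev p) \<longleftrightarrow> successively (adj G) p"
  unfolding successively_rev by (rule arg_cong[of _ _ "\<lambda>P. successively P p"])
    (auto simp: fun_eq_iff dest: adj_sym)

lemma upath_rev: "upath G (rev p) \<longleftrightarrow> upath G p"
  by (auto simp: upath_def successively_adj_rev simp del: successively_rev)

text \<open>For root paths \<open>p\<close> and \<open>q\<close>, the list \<open>m\<close> leads to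
  the meet of their end nodes: the third condition says that the common prefix cannot be
  prolonged.\<close>

lemma list_meet:
  obtains m a b where "p = m @ a" "q = m @ b" "a = [] \<or> b = [] \<or> hd a \<noteq> hd b"
proof -
  have "\<exists>m a b. p = m @ a \<and> q = m @ b \<and> (a = [] \<or> b = [] \<or> hd a \<noteq> hd b)"
  proof (induction p arbitrary: q)
    case Nil
    then show ?case by auto
  next
    case (Cons x p)
    show ?case
    proof (cases "q \<noteq> [] \<and> hd q = x")
      case True
      then obtain q' where q: "q = x # q'" by (cases q) auto
      obtain m a b where "p = m @ a" "q' = m @ b" "a = [] \<or> b = [] \<or> hd a \<noteq> hd b"
        using Cons.IH by blast
      then show ?thesis unfolding q
        by (intro exI[of _ "x # m"] exI[of _ a] exI[of _ b]) auto
    next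
      case False
      then show ?thesis
        by (intro exI[of _ "[]"] exI[of _ "x # p"] exI[of _ q]) auto
    qed
  qed
  then show ?thesis using that by blast
qed


section \<open>Trees as systems of root paths\<close>

text \<open>
  A rooted tree is encoded by the set of the vertex lists of its paths from the root.  The tree
  order becomes the prefix order on these lists, one tree is an initial part of another iff
  its set of lists is a subset, and unions of chains are set unions.
\<close>

locale root_paths =
  fixes A :: "'a list set" and r :: 'a
  assumes root: "[r] \<in> A"
    and nonempty: "p \<in> A \<Longrightarrow> p \<noteq> []"
    and hd_root: "p \<in> A \<Longrightarrow> hd p = r"
    and butlast_closed: "p @ [x] \<in> A \<Longrightarrow> p \<noteq> [] \<Longrightarrow> p \<in> A"
    and inj_last: "inj_on last A"

definition tree_of :: "'a list set \<Rightarrow> 'a ugraph" where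
  "tree_of A = \<lparr>verts = last ` A, edges = {{last p, x} |p x. p \<in> A \<and> p @ [x] \<in> A}\<rparr>"

lemma verts_tree_of [simp]: "verts (tree_of A) = last ` A"
  by (simp add: tree_of_def)

lemma adj_tree_of:
  "adj (tree_of A) x y \<longleftrightarrow>
     (\<exists>p\<in>A. last p = x \<and> p @ [y] \<in> A \<or> last p = y \<and> p @ [x] \<in> A)"
  by (fastforce simp: tree_of_def adj_def doubleton_eq_iff)

context root_paths
begin

lemma prefix_closed: "p @ s \<in> A \<Longrightarrow> p \<noteq> [] \<Longrightarrow> p \<in> A"
proof (induction s rule: rev_induct)
  case (snoc x s)
  then show ?case using butlast_closed[of "p @ s" x] by simp
qed simp

lemma last_eqD: "p \<in> A \<Longrightarrow> q \<in> A \<Longrightarrow> last p = last q \<Longrightarrow> p = q"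
  using inj_last by (auto dest: inj_onD)

lemma mem_path:
  assumes "p \<in> A" "x \<in> set p"
  obtains q s where "p = q @ s" "q \<in> A" "last q = x"
proof -
  obtain a b where p: "p = a @ x # b" using assms(2) split_list by metis
  then have "a @ [x] \<in> A" using assms(1) prefix_closed[of "a @ [x]" b] by simp
  with p show ?thesis using that[of "a @ [x]" b] by simp
qed

lemma mem_path_prefix:
  assumes "p \<in> A" "q \<in> A" "last q \<in> set p"
  shows "prefix q p"
proof -
  obtain q' s where "p = q' @ s" "q' \<in> A" "last q' = last q"
    using mem_path[OF assms(1,3)] .
  then show ?thesis using last_eqD[of q' q] assms(2) by auto
qed

lemma distinct: "p \<in> A \<Longrightarrow> distinct p"
proof (induction p rule: rev_induct)
  case (snoc x p)
  show ?case
  proof (cases "p = []")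
    case False
    then have p: "p \<in> A" using snoc.prems butlast_closed by blast
    have "x \<notin> set p"
    proof
      assume "x \<in> set p"
      then have "prefix (p @ [x]) p" using mem_path_prefix[OF p snoc.prems] by simp
      then show False by (auto dest: prefix_length_le)
    qed
    then show ?thesis using snoc.IH[OF p] by simp
  qed simp
qed simp

lemma set_path_subset: "p \<in> A \<Longrightarrow> set p \<subseteq> last ` A"
  by (auto elim: mem_path)

lemma successively_path: "p \<in> A \<Longrightarrow> successively (adj (tree_of A)) p"
proof (induction p rule: rev_induct)
  case (snoc x p)
  show ?case
  proof (cases "p = []")
    case False
    then have "p \<in> A" using snoc.prems butlast_closed by blast
    then show ?thesis using snoc by (auto simp: successively_append_iff adj_tree_of)
  qed simp
qed simp

text \<open>The branches above the meet share no vertex, since a shared vertex would have two root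
  paths. Hence going down one branch and up the other is a path.\<close>

lemma meet_path:
  assumes m: "m \<noteq> []" and a: "m @ a \<in> A" and b: "m @ b \<in> A"
    and ab: "a = [] \<or> b = [] \<or> hd a \<noteq> hd b"
  shows "upath_between (tree_of A) (last (m @ a)) (rev a @ last m # b) (last (m @ b))"
proof -
  define m' where "m' = butlast m"
  have m': "m = m' @ [last m]" using m by (simp add: m'_def)
  have a': "m' @ last m # a \<in> A" and b': "m' @ last m # b \<in> A"
    using a b m' by (metis append_Cons append_Nil append_assoc)+
  have "set a \<inter> set b = {}"
  proof (rule ccontr)
    assume "set a \<inter> set b \<noteq> {}"
    then obtain x where "x \<in> set a" "x \<in> set b" by blast
    then obtain a1 a2 b1 b2 where e: "a = a1 @ x # a2" "b = b1 @ x # b2"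
      by (meson split_list)
    have "m @ a1 @ [x] \<in> A" "m @ b1 @ [x] \<in> A"
      using a b e prefix_closed[of "m @ a1 @ [x]" a2] prefix_closed[of "m @ b1 @ [x]" b2] by simp_all
    from last_eqD[OF this] have "a1 = b1" by simp
    then show False using ab e by (cases a1) auto
  qed
  then have d: "distinct (rev a @ last m # b)"
    using distinct[OF a'] distinct[OF b'] by auto
  have sub: "set (rev a @ last m # b) \<subseteq> last ` A"
    using set_path_subset[OF a'] set_path_subset[OF b'] by auto
  have "successively (adj (tree_of A)) (last m # a)" "successively (adj (tree_of A)) (last m # b)"
    using successively_path[OF a'] successively_path[OF b'] by (auto simp: successively_append_iff)
  then have "successively (adj (tree_of A)) (rev a @ last m # b)"
    using successively_adj_rev[of "tree_of A" "last m # a"]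
    by (auto simp: successively_append_iff successively_Cons)
  then show ?thesis using d sub m
    by (auto simp: upath_between_def upath_def hd_append hd_rev last_append)
qed

lemma path_in_tree: "p \<in> A \<Longrightarrow> upath_between (tree_of A) r p (last p)"
  using meet_path[of "[r]" "[]" "tl p"] nonempty[of p] hd_root[of p] root by (cases p) auto

text \<open>Tailored to \<open>no_cycle\<close>: on a cycle, a vertex with the longest root path has
  two neighbours whose root paths are no longer, and both would have to be its parent.\<close>

lemma adj_longest:
  assumes "q \<in> A" "adj (tree_of A) (last q) y"
    and "\<And>p. p \<in> A \<Longrightarrow> last p = y \<Longrightarrow> length p \<le> length q"
  shows "y = last (butlast q)"
proof -
  obtain p where p: "p \<in> A" "last p = last q \<and> p @ [y] \<in> A \<or> last p = y \<and> p @ [last q] \<in> A"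
    using assms(2) by (auto simp: adj_tree_of)
  from p(2) show ?thesis
  proof
    assume *: "last p = last q \<and> p @ [y] \<in> A"
    then have "p = q" using last_eqD[OF p(1) assms(1)] by blast
    then show ?thesis using assms(3)[of "p @ [y]"] * by simp
  next
    assume *: "last p = y \<and> p @ [last q] \<in> A"
    then have "p @ [last q] = q" using last_eqD[of "p @ [last q]" q] assms(1) by simp
    then show ?thesis using * by (metis butlast_snoc)
  qed
qed

lemma no_cycle: "\<not> ucycle (tree_of A) c"
proof
  assume c: "ucycle (tree_of A) c"
  then have c': "set c \<subseteq> last ` A" "distinct c" "successively (adj (tree_of A)) c" "3 \<le> length c"
    "adj (tree_of A) (last c) (hd c)" "c \<noteq> []"
    by (auto simp: ucycle_def upath_def)
  define Q where "Q = {q\<in>A. last q \<in> set c}"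
  have "last ` Q \<subseteq> set c" "inj_on last Q"
    using inj_last by (auto simp: Q_def inj_on_def)
  then have "finite Q" by (meson finite_imageD finite_set finite_subset)
  moreover have "Q \<noteq> {}" using c'(1,6) by (cases c) (auto simp: Q_def)
  ultimately obtain q where q: "q \<in> Q" "\<And>p. p \<in> Q \<Longrightarrow> length p \<le> length q"
    using ex_min_if_finite[of "(\<lambda>q. - int (length q)) ` Q"] by (force simp: not_less)
  obtain a b where ab: "c = a @ last q # b" using q(1) by (auto simp: Q_def dest: split_list)
  \<comment> \<open>The cycle opened at \<open>last q\<close>: the ends of \<open>w\<close> are the
    two neighbours of that vertex on the cycle.\<close>
  define w where "w = b @ a"
  have w: "2 \<le> length w" "distinct w" "set w \<subseteq> set c" using c' ab by (auto simp: w_def)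
  have "adj (tree_of A) (last q) (hd w)"
    using c' w(1) unfolding ab w_def by (cases b; cases a) (auto simp: successively_append_iff successively_Cons)
  moreover have "adj (tree_of A) (last q) (last w)"
    using c' w(1) unfolding ab w_def
    by (cases "a = []"; cases "b = []")
      (auto simp: successively_append_iff successively_Cons intro!: adj_sym[of _ _ "last q"])
  moreover have "w \<noteq> []" using w(1) by auto
  then have "hd w \<in> set c" "last w \<in> set c"
    using w(3) hd_in_set last_in_set by blast+
  moreover have "y = last (butlast q)" if "adj (tree_of A) (last q) y" "y \<in> set c" for y
  proof (rule adj_longest)
    show "length p \<le> length q" if "p \<in> A" "last p = y" for p
      using q(2)[of p] that \<open>y \<in> set c\<close> by (simp add: Q_def)
  qed (use q(1) that in \<open>simp_all add: Q_def\<close>)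
  ultimately have "hd w = last w" by metis
  with w show False by (cases w) (auto split: if_splits)
qed

lemma utree_tree_of: "utree (tree_of A)"
proof -
  have "ugraph (tree_of A)" unfolding ugraph_def
  proof
    fix e assume "e \<in> edges (tree_of A)"
    then obtain p x where p: "e = {last p, x}" "p \<in> A" "p @ [x] \<in> A" by (auto simp: tree_of_def)
    then have "last p \<noteq> x" using distinct[OF p(3)] nonempty[OF p(2)] by auto
    then show "\<exists>u\<in>verts (tree_of A). \<exists>v\<in>verts (tree_of A). u \<noteq> v \<and> e = {u, v}"
      using p by (intro bexI[of _ "last p"] bexI[of _ x]) force+
  qed
  moreover have "\<exists>s. upath_between (tree_of A) (last p) s (last q)" if "p \<in> A" "q \<in> A" for p q
  proof -
    obtain m a b where mab: "p = m @ a" "q = m @ b" "a = [] \<or> b = [] \<or> hd a \<noteq> hd b"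
      by (rule list_meet)
    then have "m \<noteq> []" using that nonempty hd_root by (metis append_Nil)
    then show ?thesis using meet_path[of m a b] that mab by blast
  qed
  ultimately have "connected_ugraph (tree_of A)"
    using root by (auto simp: connected_ugraph_def)
  then show ?thesis using no_cycle by (simp add: utree_def)
qed

end

text \<open>The second path may continue past \<open>v\<close>, so that a caller can stop at the
  first vertex of one path that lies on the other without shortening the latter. The last assumption
  excludes two copies of a single edge.\<close>

lemma cycle_from_two_paths:
  assumes p: "upath T (r # p @ [v])" and q: "upath T (r # q @ v # q')"
    and "set p \<inter> set q = {}" and "p \<noteq> [] \<or> q \<noteq> []"
  shows "ucycle T (r # p @ v # rev q)"
proof -
  have "upath T (r # q @ [v])" using upath_appendD1[of T "r # q @ [v]" q'] q by simp
  then have "upath T (v # rev q @ [r])" using upath_rev[of T "r # q @ [v]"] by simp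
  then show ?thesis using p assms(3,4)
    by (auto simp: ucycle_def upath_def successively_append_iff successively_Cons Suc_le_eq
        hd_append split: if_splits)
qed

text \<open>Common initial vertices are stripped by induction; where the paths part, the first
  vertex of one that lies on the other closes a cycle.\<close>

lemma upath_unique:
  assumes T: "\<And>c. \<not> ucycle T c"
  shows "upath T p \<Longrightarrow> upath T q \<Longrightarrow> hd p = hd q \<Longrightarrow> last p = last q \<Longrightarrow> p = q"
proof (induction p arbitrary: q)
  case Nil
  then show ?case by (simp add: upath_def)
next
  case (Cons r p)
  from Cons.prems obtain q' where q: "q = r # q'" by (cases q) (auto simp: upath_def)
  show ?case
  proof (cases "p = [] \<or> q' = []")
    case True
    then show ?thesis using Cons.prems q by (auto simp: upath_def split: if_splits)
  next
    case False
    have p': "upath T p" "upath T q'"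
      using Cons.prems(1,2) False upath_appendD2[of T "[r]"] by (auto simp: q)
    show ?thesis
    proof (cases "hd p = hd q'")
      case True
      then show ?thesis using Cons.IH[OF p'] Cons.prems False q by simp
    next
      case hd: False
      have "\<exists>x\<in>set p. x \<in> set q'" using Cons.prems(4) False q
        by (metis last_ConsR last_in_set)
      then obtain p1 v p2 where p1: "p = p1 @ v # p2" "v \<in> set q'" "\<forall>x\<in>set p1. x \<notin> set q'"
        using split_list_first_prop[of p "\<lambda>x. x \<in> set q'"] by blast
      then obtain q1 q2 where q1: "q' = q1 @ v # q2" by (meson split_list)
      have "upath T (r # p1 @ [v])"
        using Cons.prems(1) p1 upath_appendD1[of T "r # p1 @ [v]" p2] by simp
      moreover have "p1 \<noteq> [] \<or> q1 \<noteq> []" using hd p1 q1 by auto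
      ultimately have "ucycle T (r # p1 @ v # rev q1)"
        using Cons.prems(2) p1 q1 q by (intro cycle_from_two_paths[of _ _ _ _ _ q2]) auto
      then show ?thesis using T by blast
    qed
  qed
qed

definition root_paths_of :: "'a ugraph \<Rightarrow> 'a \<Rightarrow> 'a list set" where
  "root_paths_of T r = {p. upath T p \<and> hd p = r}"

text \<open>Converse of \<open>utree_tree_of\<close>: the encoding reaches every rooted
  tree.\<close>

lemma root_paths_of:
  assumes "utree T" "r \<in> verts T"
  shows "root_paths (root_paths_of T r) r" and "tree_of (root_paths_of T r) = T"
proof -
  let ?A = "root_paths_of T r"
  have T: "\<And>c. \<not> ucycle T c" and con: "connected_ugraph T" and ug: "ugraph T"
    using assms(1) by (auto simp: utree_def connected_ugraph_def)
  show rp: "root_paths ?A r"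
  proof
    show "inj_on last ?A"
      by (intro inj_onI) (auto simp: root_paths_of_def intro: upath_unique[OF T])
    show "p \<in> ?A" if "p @ [x] \<in> ?A" "p \<noteq> []" for p x
      using that upath_appendD1 by (auto simp: root_paths_of_def)
  qed (use assms(2) in \<open>auto simp: root_paths_of_def upath_def\<close>)
  have ex: "\<exists>p\<in>?A. last p = v" if "v \<in> verts T" for v
    using con assms(2) that by (auto simp: connected_ugraph_def upath_between_def root_paths_of_def)
  then have v: "last ` ?A = verts T"
    by (auto simp: root_paths_of_def upath_def image_iff)
  have "{u, w} \<in> edges T \<longleftrightarrow> {u, w} \<in> edges (tree_of ?A)" for u w
  proof
    assume e: "{u, w} \<in> edges T"
    then have uw: "adj T u w" "u \<in> verts T" "w \<in> verts T" "u \<noteq> w"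
      using adj_vertsD[OF ug] by (auto simp: adj_def)
    obtain p where p: "p \<in> ?A" "last p = u" using ex uw by blast
    show "{u, w} \<in> edges (tree_of ?A)"
    proof (cases "w \<in> set p")
      case False
      then have "p @ [w] \<in> ?A"
        using p uw root_paths.nonempty[OF rp p(1)] by (auto simp: root_paths_of_def upath_snoc)
      then show ?thesis using p by (auto simp: tree_of_def)
    next
      \<comment> \<open>If \<open>w\<close> lies on the root path of \<open>u\<close>, it is the
        last but one vertex there, as otherwise the edge would close a cycle.\<close>
      case True
      then obtain a b where "p = a @ w # b" by (meson split_list)
      then obtain b' where ab: "p = a @ w # b' @ [u]" using p(2) uw(4)
        by (cases b rule: rev_cases) auto
      have up: "upath T p" using p by (simp add: root_paths_of_def)
      then have "upath T (w # b' @ [u])" using ab upath_appendD2 by blast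
      then have "b' = []" using T[of "w # b' @ [u]"] uw by (cases b') (auto simp: ucycle_def)
      then have "(a @ [w]) @ [u] \<in> ?A" using ab p by simp
      moreover have "a @ [w] \<in> ?A" using calculation root_paths.butlast_closed[OF rp] by blast
      ultimately show ?thesis unfolding adj_def[symmetric] adj_tree_of by (intro bexI[of _ "a @ [w]"]) auto
    qed
  next
    assume "{u, w} \<in> edges (tree_of ?A)"
    then obtain p where "p \<in> ?A" "last p = u \<and> p @ [w] \<in> ?A \<or> last p = w \<and> p @ [u] \<in> ?A"
      unfolding adj_def[symmetric] adj_tree_of by blast
    then have "adj T u w"
      using adj_sym[of T w u] root_paths.nonempty[OF rp \<open>p \<in> ?A\<close>]
      by (auto simp: root_paths_of_def upath_snoc)
    then show "{u, w} \<in> edges T" by (simp add: adj_def)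
  qed
  note e = this
  have "edges (tree_of ?A) = edges T"
  proof (intro equalityI subsetI)
    fix x assume "x \<in> edges (tree_of ?A)"
    moreover then obtain u w where "x = {u, w}" by (auto simp: tree_of_def)
    ultimately show "x \<in> edges T" using e by simp
  next
    fix x assume "x \<in> edges T"
    moreover then obtain u w where "x = {u, w}" using ug by (auto simp: ugraph_def)
    ultimately show "x \<in> edges (tree_of ?A)" using e by simp
  qed
  then show "tree_of ?A = T" using v by (intro ugraph.equality) auto
qed


section \<open>Walks\<close>

text \<open>Walks compose without any care for repeated vertices; \<open>reach_upath\<close>
  extracts a path when one is needed.\<close>

inductive reach :: "'v ugraph \<Rightarrow> 'v set \<Rightarrow> 'v \<Rightarrow> 'v \<Rightarrow> bool" for G S x where
  refl: "x \<in> S \<Longrightarrow> reach G S x x"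
| step: "reach G S x y \<Longrightarrow> adj G y z \<Longrightarrow> z \<in> S \<Longrightarrow> reach G S x z"

lemma reach_mem: "reach G S x y \<Longrightarrow> x \<in> S \<and> y \<in> S"
  by (induction rule: reach.induct) auto

lemma reach_trans: "reach G S y z \<Longrightarrow> reach G S x y \<Longrightarrow> reach G S x z"
  by (induction rule: reach.induct) (auto intro: reach.intros)

lemma reach_adj: "adj G x y \<Longrightarrow> x \<in> S \<Longrightarrow> y \<in> S \<Longrightarrow> reach G S x y"
  by (blast intro: reach.intros)

lemma reach_sym: "reach G S x y \<Longrightarrow> reach G S y x"
proof (induction rule: reach.induct)
  case (step y z)
  then show ?case using reach_trans[of G S y x z] reach_adj[of G z y S] reach_mem adj_sym by metis
qed (auto intro: reach.intros)

lemma reach_mono: "reach G S x y \<Longrightarrow> S \<subseteq> S' \<Longrightarrow> reach G S' x y"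
  by (induction rule: reach.induct) (auto intro: reach.intros)

lemma reach_upath:
  assumes "reach G S x y" "S \<subseteq> verts G"
  shows "\<exists>p. upath_between G x p y \<and> set p \<subseteq> S"
  using assms(1)
proof (induction rule: reach.induct)
  case refl
  then show ?case using assms(2) by (intro exI[of _ "[x]"]) (auto simp: upath_between_def upath_def)
next
  case (step y z)
  then obtain p where p: "upath_between G x p y" "set p \<subseteq> S" by blast
  show ?case
  proof (cases "z \<in> set p")
    case True
    then obtain a b where ab: "p = a @ z # b" by (meson split_list)
    then show ?thesis using p upath_appendD1[of G "a @ [z]" b]
      by (intro exI[of _ "a @ [z]"]) (auto simp: upath_between_def hd_append split: if_splits)
  next
    case False
    moreover have "p \<noteq> []" using p by (auto simp: upath_between_def upath_def)
    ultimately show ?thesis using p step assms(2)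
      by (intro exI[of _ "p @ [z]"]) (auto simp: upath_between_def upath_snoc)
  qed
qed

lemma upath_reach: "upath G p \<Longrightarrow> set p \<subseteq> S \<Longrightarrow> reach G S (hd p) (last p)"
proof (induction p rule: rev_induct)
  case (snoc x p)
  then show ?case
    by (cases "p = []") (auto simp: upath_snoc intro: reach.intros)
qed (simp add: upath_def)

lemma connected_reach:
  assumes "connected_ugraph G" "x \<in> verts G" "y \<in> verts G"
  shows "reach G (verts G) x y"
proof -
  obtain p where "upath_between G x p y" using assms by (auto simp: connected_ugraph_def)
  then show ?thesis using upath_reach[of G p "verts G"] by (auto simp: upath_between_def upath_def)
qed

text \<open>\<open>linked G W x y\<close>: some walk of positive length from \<open>x\<close> to \<open>y\<close> has all inner vertices outside \<open>W\<close>.\<close>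

inductive linked :: "'v ugraph \<Rightarrow> 'v set \<Rightarrow> 'v \<Rightarrow> 'v \<Rightarrow> bool" for G W x where
  edge: "adj G x y \<Longrightarrow> linked G W x y"
| step: "linked G W x y \<Longrightarrow> y \<notin> W \<Longrightarrow> adj G y z \<Longrightarrow> linked G W x z"

lemma linked_trans: "linked G W y z \<Longrightarrow> y \<notin> W \<Longrightarrow> linked G W x y \<Longrightarrow> linked G W x z"
  by (induction rule: linked.induct) (auto intro: linked.intros)

lemma linked_sym: "linked G W x y \<Longrightarrow> linked G W y x"
proof (induction rule: linked.induct)
  case (step y z)
  then show ?case using linked_trans[of G W y x z] by (metis linked.edge adj_sym)
qed (auto intro: linked.intros adj_sym)

lemma linked_antimono: "linked G W x y \<Longrightarrow> W' \<subseteq> W \<Longrightarrow> linked G W' x y"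
  by (induction rule: linked.induct) (auto intro: linked.intros)

lemma linked_reach: "reach G S y z \<Longrightarrow> linked G W x y \<Longrightarrow> S \<inter> W = {} \<Longrightarrow> linked G W x z"
proof (induction rule: reach.induct)
  case (step u v)
  then show ?case using reach_mem[OF step.hyps(1)] by (blast intro: linked.step)
qed auto

text \<open>As \<open>x \<in> W\<close>, the walk never returns to its start, so a repetition
  concerns only later vertices and can be cut out.\<close>

lemma linked_upath:
  assumes "ugraph G" "x \<in> W" "linked G W x y" "x \<noteq> y"
  shows "\<exists>p. upath G (x # p @ [y]) \<and> set p \<inter> W = {}"
  using assms(3,4)
proof (induction rule: linked.induct)
  case (edge y)
  then show ?case using adj_vertsD[OF assms(1) edge(1)]
    by (intro exI[of _ "[]"]) (auto simp: upath_def)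
next
  case (step y z)
  then obtain p where p: "upath G (x # p @ [y])" "set p \<inter> W = {}" using assms(2) by blast
  have zy: "z \<noteq> y" "z \<in> verts G" using adj_vertsD[OF assms(1) step(3)] by auto
  show ?case
  proof (cases "z \<in> set p")
    case True
    then obtain a b where ab: "p = a @ z # b" by (meson split_list)
    then show ?thesis using p upath_appendD1[of G "x # a @ [z]" "b @ [y]"]
      by (intro exI[of _ a]) auto
  next
    case False
    then have "upath G ((x # p @ [y]) @ [z])"
      using p(1) zy step by (subst upath_snoc) auto
    then show ?thesis using p(2) step(2) by (intro exI[of _ "p @ [y]"]) auto
  qed
qed

lemma upath_linked: "upath G (x # p @ [y]) \<Longrightarrow> set p \<inter> W = {} \<Longrightarrow> linked G W x y"
proof (induction p arbitrary: y rule: rev_induct)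
  case Nil
  then show ?case by (auto simp: upath_def intro: linked.intros)
next
  case (snoc z p)
  then show ?case using upath_snoc[of G "x # p @ [z]" y] by (auto intro: linked.step)
qed

lemma linked_from:
  "reach G S x y \<Longrightarrow> x \<in> W \<Longrightarrow> y \<notin> W \<Longrightarrow> \<exists>w\<in>W. linked G W w y"
proof (induction rule: reach.induct)
  case (step y z)
  then show ?case by (cases "y \<in> W") (blast intro: linked.intros)+
qed auto


section \<open>Normal trees\<close>

text \<open>Normality is asked of all linked pairs instead of the endvertices of
  \<open>T\<close>-paths. The extra pairs, equal vertices and tree neighbours, are comparable
  anyway, and walks are easier to prolong than paths.\<close>

locale normal_paths = root_paths A r for A and r :: 'v +
  fixes G :: "'v ugraph"
  assumes graph: "ugraph G"
    and root_vert: "r \<in> verts G"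
    and adj_path: "p @ [x] \<in> A \<Longrightarrow> p \<noteq> [] \<Longrightarrow> adj G (last p) x"
    and normal: "p \<in> A \<Longrightarrow> q \<in> A \<Longrightarrow> linked G (last ` A) (last p) (last q) \<Longrightarrow> prefix p q \<or> prefix q p"
begin

lemma upath_path: "p \<in> A \<Longrightarrow> upath G p"
proof (induction p rule: rev_induct)
  case Nil
  then show ?case using nonempty by blast
next
  case (snoc x p)
  show ?case
  proof (cases "p = []")
    case True
    then show ?thesis using snoc hd_root[of "[x]"] root_vert by (simp add: upath_def)
  next
    case False
    then show ?thesis using snoc butlast_closed[of p x] distinct[of "p @ [x]"]
        adj_path[of p x] adj_vertsD[OF graph, of "last p" x] by (auto simp: upath_snoc)
  qed
qed

lemma verts_subset: "last ` A \<subseteq> verts G"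
proof
  fix x assume "x \<in> last ` A"
  then obtain p where "p \<in> A" "x = last p" by blast
  then show "x \<in> verts G" using upath_path[of p] by (auto simp: upath_def)
qed

lemma subgraph_tree_of: "subgraph_of (tree_of A) G"
  using utree_tree_of graph verts_subset adj_path nonempty
  by (auto simp: subgraph_of_def utree_def connected_ugraph_def tree_of_def adj_def)

lemma normal_tree_tree_of: "normal_tree G (tree_of A) r"
proof -
  have le: "tree_le (tree_of A) r x y"
    if "p \<in> A" "q \<in> A" "last p = x" "last q = y" "prefix p q" for p q x y
    using path_in_tree[of q] that nonempty[of p]
    by (auto simp: tree_le_def prefix_def intro!: exI[of _ q])
  have "tree_le (tree_of A) r (hd s) (last s) \<or> tree_le (tree_of A) r (last s) (hd s)"
    if s: "T_path G (tree_of A) s" for s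
  proof -
    obtain x y s' where s': "s = x # s' @ [y]"
      using s by (cases s rule: list.exhaust, simp add: T_path_def)
        (metis T_path_def Suc_1 length_Cons list.size(3) not_less_eq_eq le0 rev_exhaust One_nat_def)
    have "x \<in> last ` A" "y \<in> last ` A" "set s' \<inter> last ` A = {}"
      using s unfolding s' T_path_def upath_def by auto
    moreover obtain p q where "p \<in> A" "last p = x" "q \<in> A" "last q = y" using calculation by blast
    moreover have "linked G (last ` A) x y"
      using s calculation by (intro upath_linked[of _ _ s']) (auto simp: s' T_path_def)
    ultimately show ?thesis using normal[of p q] le[of p q] le[of q p] by (auto simp: s')
  qed
  then show ?thesis
    using utree_tree_of root subgraph_tree_of by (force simp: normal_tree_def)
qed

end

lemma normal_tree_normal_paths:
  assumes "normal_tree G T r"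
  shows "normal_paths (root_paths_of T r) r G" and "last ` root_paths_of T r = verts T"
proof -
  let ?A = "root_paths_of T r"
  have T: "utree T" "r \<in> verts T" "subgraph_of T G"
    and n: "\<And>p. T_path G T p \<Longrightarrow> tree_le T r (hd p) (last p) \<or> tree_le T r (last p) (hd p)"
    using assms by (auto simp: normal_tree_def)
  interpret root_paths ?A r by (rule root_paths_of(1)[OF T(1,2)])
  note t = root_paths_of(2)[OF T(1,2)]
  show v: "last ` ?A = verts T" using t verts_tree_of by metis
  have gG: "ugraph G" using T(3) by (simp add: subgraph_of_def)
  have le: "prefix p q" if pq: "tree_le T r (last p) (last q)" "p \<in> ?A" "q \<in> ?A" for p q
  proof -
    obtain s where "upath_between T r s (last q)" "last p \<in> set s"
      using pq(1) unfolding tree_le_def by blast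
    then have "s \<in> ?A" "last s = last q" by (auto simp: upath_between_def root_paths_of_def)
    then have "s = q" using last_eqD pq by blast
    then show ?thesis using mem_path_prefix pq \<open>last p \<in> set s\<close> by blast
  qed
  show "normal_paths ?A r G"
  proof
    show "adj G (last p) x" if "p @ [x] \<in> ?A" "p \<noteq> []" for p x
      using that T(3) by (auto simp: root_paths_of_def upath_snoc subgraph_of_def adj_def)
    show "prefix p q \<or> prefix q p"
      if pq: "p \<in> ?A" "q \<in> ?A" and l: "linked G (last ` ?A) (last p) (last q)" for p q
    proof (cases "last p = last q")
      case True
      then show ?thesis using last_eqD pq by blast
    next
      case False
      obtain s where s: "upath G (last p # s @ [last q])" "set s \<inter> verts T = {}"
        using linked_upath[OF gG _ l False] pq v by blast
      show ?thesis
      proof (cases "s = [] \<and> adj T (last p) (last q)")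
        case True
        then obtain p' where "p' \<in> ?A"
          "last p' = last p \<and> p' @ [last q] \<in> ?A \<or> last p' = last q \<and> p' @ [last p] \<in> ?A"
          using t adj_tree_of by metis
        then show ?thesis using last_eqD pq by (metis last_snoc prefixI)
      next
        case False
        then have "T_path G T (last p # s @ [last q])"
          using s pq v by (auto simp: T_path_def Suc_le_eq)
        from n[OF this] show ?thesis using le pq by auto
      qed
    qed
  qed (use T gG in \<open>auto simp: subgraph_of_def\<close>)
qed

lemma normally_spanned_iff:
  "normally_spanned G U \<longleftrightarrow> U \<subseteq> verts G \<and> (\<exists>A r. normal_paths A r G \<and> U \<subseteq> last ` A)"
  unfolding normally_spanned_def
  using normal_paths.normal_tree_tree_of normal_tree_normal_paths by (metis verts_tree_of)


section \<open>Unions of normally spanned sets\<close>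

text \<open>The separator \<open>S\<close> may meet both the ray and \<open>U\<close>, because
  \<open>reach\<close> in the complement of \<open>S\<close> fails when an endpoint lies in
  \<open>S\<close>. In particular, finitely many vertices of the ray may be discarded.\<close>

definition dispersed :: "'v ugraph \<Rightarrow> 'v set \<Rightarrow> bool" where
  "dispersed G U \<longleftrightarrow>
     (\<forall>f. ray G f \<longrightarrow> (\<exists>S. finite S \<and> (\<forall>n. \<forall>u\<in>U. \<not> reach G (- S) (f n) u)))"

lemma dispersed_Un:
  assumes "dispersed G U" "dispersed G U'"
  shows "dispersed G (U \<union> U')"
  unfolding dispersed_def
proof (intro allI impI)
  fix f assume "ray G f"
  then obtain S S' where S: "finite S" "finite S'" "\<And>n u. u \<in> U \<Longrightarrow> \<not> reach G (- S) (f n) u"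
    "\<And>n u. u \<in> U' \<Longrightarrow> \<not> reach G (- S') (f n) u"
    using assms unfolding dispersed_def by meson
  have "\<not> reach G (- (S \<union> S')) (f n) u" if "u \<in> U \<union> U'" for n u
    using that S(3)[of u n] S(4)[of u n] reach_mono[of G "- (S \<union> S')" "f n" u "- S"]
      reach_mono[of G "- (S \<union> S')" "f n" u "- S'"] by auto
  then show "\<exists>S. finite S \<and> (\<forall>n. \<forall>u\<in>U \<union> U'. \<not> reach G (- S) (f n) u)"
    using S(1,2) by blast
qed

lemma prefix_take_eq: "prefix p q \<Longrightarrow> k \<le> length p \<Longrightarrow> take k p = take k q"
  by (auto simp: prefix_def)

lemma ray_eventually_avoids:
  assumes "inj f" "finite S"
  obtains N :: nat where "\<And>i. N \<le> i \<Longrightarrow> f i \<notin> S"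
proof -
  have "finite (f -` S)" using assms by (simp add: finite_vimageI)
  then obtain N where "\<forall>i\<in>f -` S. i < N" using finite_nat_set_iff_bounded by blast
  then have "f i \<notin> S" if "N \<le> i" for i using that by (meson leD vimageI2)
  then show ?thesis by (rule that)
qed

lemma ray_reach:
  assumes "ray G f" "\<And>i. N \<le> i \<Longrightarrow> f i \<in> S" "N \<le> n"
  shows "reach G S (f N) (f n)"
  using assms(3)
proof (induction n rule: dec_induct)
  case base
  then show ?case using assms(2) by (auto intro: reach.intros)
next
  case (step n)
  then show ?case using assms by (auto simp: ray_def intro: reach.step)
qed

section \<open>Levels and chains of a normal tree\<close>

context normal_paths
begin

text \<open>Consecutive tree vertices on a walk are linked, hence comparable, and comparable root
  paths of length at least \<open>k\<close> share their first \<open>k\<close> entries. The second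
  conjunct remembers the last tree vertex while the walk is off the tree.\<close>

lemma take_eq_if_reach:
  assumes "reach G S (last p) y" "p \<in> A"
    and high: "\<And>q. q \<in> A \<Longrightarrow> reach G S (last p) (last q) \<Longrightarrow> k \<le> length q"
  shows "(\<forall>q\<in>A. last q = y \<longrightarrow> take k q = take k p) \<and>
    (y \<notin> last ` A \<longrightarrow> (\<exists>q\<in>A. k \<le> length q \<and> take k q = take k p \<and> linked G (last ` A) (last q) y))"
  using assms(1)
proof (induction rule: reach.induct)
  case refl
  then show ?case using assms(2) last_eqD by auto
next
  case (step y z)
  have "\<exists>q\<in>A. k \<le> length q \<and> take k q = take k p \<and> linked G (last ` A) (last q) z"
  proof (cases "y \<in> last ` A")
    case True
    then obtain q where "q \<in> A" "last q = y" by blast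
    then show ?thesis using step high[of q] by (intro bexI[of _ q]) (auto intro: linked.edge)
  next
    case False
    then show ?thesis using step by (blast intro: linked.step)
  qed
  then obtain q where q: "q \<in> A" "k \<le> length q" "take k q = take k p"
    "linked G (last ` A) (last q) z" by blast
  have "take k q' = take k p" if q': "q' \<in> A" "last q' = z" for q'
  proof -
    have "k \<le> length q'" using high q' step.hyps reach.step by metis
    moreover have "prefix q q' \<or> prefix q' q" using normal q q' by blast
    ultimately show ?thesis using prefix_take_eq q by metis
  qed
  then show ?case using q by blast
qed

text \<open>
  If a finite set \<open>S\<close> separates a ray from the first \<open>k\<close> levels, then normality forces all tree
  vertices in the component of \<open>G - S\<close> containing a tail of the ray to lie above one common
  vertex of the next level, and adding that vertex to \<open>S\<close> suffices.
\<close>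

lemma levels_separated:
  assumes f: "ray G f"
  shows "\<exists>S. finite S \<and> (\<forall>n. \<forall>p\<in>A. length p \<le> k \<longrightarrow> \<not> reach G (- S) (f n) (last p))"
proof (induction k)
  case 0
  then show ?case using nonempty by (intro exI[of _ "{}"]) auto
next
  case (Suc k)
  then obtain S where S: "finite S"
    "\<And>n p. p \<in> A \<Longrightarrow> length p \<le> k \<Longrightarrow> \<not> reach G (- S) (f n) (last p)" by blast
  obtain N where N: "\<And>i. N \<le> i \<Longrightarrow> f i \<notin> S"
    using ray_eventually_avoids[OF _ S(1), of f] f by (auto simp: ray_def)
  define v where "v = last (take (Suc k) (SOME p. p \<in> A \<and> reach G (- S) (f N) (last p)))"
  have v: "last p = v" if p: "p \<in> A" "length p \<le> Suc k" "reach G (- S) (f N) (last p)" for p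
  proof -
    define p0 where "p0 = (SOME p. p \<in> A \<and> reach G (- S) (f N) (last p))"
    have p0: "p0 \<in> A \<and> reach G (- S) (f N) (last p0)"
      unfolding p0_def by (rule someI[of _ p]) (use p in blast)
    have "reach G (- S) (last p0) (last p)" using p p0 reach_trans reach_sym by metis
    moreover have "Suc k \<le> length q" if "q \<in> A" "reach G (- S) (last p0) (last q)" for q
      using that p0 S(2)[of q N] reach_trans[of G "- S" "last p0" "last q" "f N"] by force
    ultimately have "take (Suc k) p = take (Suc k) p0"
      using take_eq_if_reach[of "- S" p0 "last p" "Suc k"] p p0 by blast
    then show ?thesis using p(2) by (simp add: v_def p0_def)
  qed
  \<comment> \<open>The first \<open>N\<close> vertices of the ray may lie in other components of
    \<open>G - S\<close> than the tail, so they are deleted as well.\<close>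
  have "\<not> reach G (- (S \<union> f ` {..<N} \<union> {v})) (f n) (last p)"
    if p: "p \<in> A" "length p \<le> Suc k" for n p
  proof
    assume r: "reach G (- (S \<union> f ` {..<N} \<union> {v})) (f n) (last p)"
    then have n: "N \<le> n" "last p \<noteq> v" using reach_mem[OF r] by (auto simp: not_less)
    have "reach G (- S) (f n) (last p)" by (rule reach_mono[OF r]) auto
    moreover have "reach G (- S) (f N) (f n)" using ray_reach[OF f, of N "- S"] N n by auto
    ultimately show False using v[OF p] reach_trans n(2) by metis
  qed
  then show ?case using S(1) by (intro exI[of _ "S \<union> f ` {..<N} \<union> {v}"]) auto
qed

lemma dispersed_levels: "dispersed G {last p |p. p \<in> A \<and> length p \<le> k}"
  unfolding dispersed_def
proof (intro allI impI)
  fix f assume "ray G f"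
  from levels_separated[OF this, of k]
  show "\<exists>S. finite S \<and> (\<forall>n. \<forall>u\<in>{last p |p. p \<in> A \<and> length p \<le> k}. \<not> reach G (- S) (f n) u)"
    by (elim ex_forward) auto
qed

text \<open>An unbounded chain of the tree would give a ray with infinitely many disjoint paths to \<open>U\<close>.\<close>

lemma chain_bounded:
  assumes U: "dispersed G U"
    and down: "\<And>p. p \<in> A \<Longrightarrow> \<exists>q\<in>A. prefix p q \<and> last q \<in> U"
    and N: "N \<subseteq> A" "\<And>p q. p \<in> N \<Longrightarrow> q \<in> N \<Longrightarrow> prefix p q \<or> prefix q p"
  shows "\<exists>n. \<forall>p\<in>N. length p \<le> n"
proof (rule ccontr)
  assume "\<nexists>n. \<forall>p\<in>N. length p \<le> n"
  then have ex: "\<exists>p. p \<in> N \<and> n < length p" for n by (auto simp: not_le)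
  \<comment> \<open>Members of \<open>N\<close> are comparable, so the entry at position
    \<open>n\<close> does not depend on the chosen member.\<close>
  define f where "f n = (SOME p. p \<in> N \<and> n < length p) ! n" for n
  have f: "f n = p ! n" if "p \<in> N" "n < length p" for n p
  proof -
    define q where "q = (SOME p. p \<in> N \<and> n < length p)"
    have q: "q \<in> N" "n < length q" using someI_ex[OF ex] unfolding q_def by blast+
    have "prefix p q \<or> prefix q p" by (rule N(2)[OF that(1) q(1)])
    then have "q ! n = p ! n" using that(2) q(2) by (auto simp: prefix_def nth_append)
    then show ?thesis by (simp add: f_def q_def)
  qed
  have "inj f"
  proof (rule injI)
    fix i j assume e: "f i = f j"
    obtain p where "p \<in> N" "max i j < length p" using ex by blast
    then have "p ! i = p ! j" "distinct p" "i < length p" "j < length p"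
      using e f[of p i] f[of p j] distinct[of p] N(1) by auto
    then show "i = j" by (simp add: nth_eq_iff_index_eq)
  qed
  moreover have "f n \<in> verts G \<and> adj G (f n) (f (Suc n))" for n
  proof -
    obtain p where p: "p \<in> N" "Suc n < length p" using ex by blast
    then have "upath G p" using N(1) upath_path by blast
    then have "p ! n \<in> verts G \<and> adj G (p ! n) (p ! Suc n)"
      using p(2) by (auto simp: upath_def successively_conv_nth)
    then show ?thesis using f[OF p(1)] p(2) by simp
  qed
  ultimately have "ray G f" by (auto simp: ray_def)
  then obtain S where S: "finite S" "\<And>n u. u \<in> U \<Longrightarrow> \<not> reach G (- S) (f n) u"
    using U unfolding dispersed_def by meson
  \<comment> \<open>Only finitely many tree vertices lie in \<open>S\<close>, so the tree avoids
    \<open>S\<close> above some level \<open>m\<close>; the path climbing from \<open>f m\<close> to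
    a vertex of \<open>U\<close> then contradicts the choice of \<open>S\<close>.\<close>
  have "finite {p\<in>A. last p \<in> S}"
    by (rule inj_on_finite[OF inj_on_subset[OF inj_last] _ S(1)]) auto
  then obtain m where m: "\<And>p. p \<in> A \<Longrightarrow> last p \<in> S \<Longrightarrow> length p < m"
    using finite_nat_set_iff_bounded[of "length ` {p\<in>A. last p \<in> S}"] by auto
  obtain p where p: "p \<in> N" "m < length p" using ex by blast
  then have "p \<in> A" "p \<noteq> []" using N(1) by auto
  then have "take (Suc m) p \<in> A"
    using prefix_closed[of "take (Suc m) p" "drop (Suc m) p"] by simp
  then obtain q where q: "q \<in> A" "prefix (take (Suc m) p) q" "last q \<in> U" using down by blast
  then obtain s where s: "q = take m p @ f m # s"
    using p f[OF p] by (auto simp: prefix_def take_Suc_conv_app_nth)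
  have "x \<notin> S" if "x \<in> set (f m # s)" for x
  proof
    assume x: "x \<in> S"
    obtain a b where "f m # s = a @ x # b" using \<open>x \<in> set (f m # s)\<close> by (meson split_list)
    then have "q = (take m p @ a @ [x]) @ b" using s by simp
    then have "take m p @ a @ [x] \<in> A" using q(1) prefix_closed by blast
    from m[OF this] show False using x p by simp
  qed
  then have "set (f m # s) \<subseteq> - S" by blast
  moreover have "upath G (f m # s)"
    using upath_path[OF q(1)] upath_appendD2[of G "take m p" "f m # s"] by (simp add: s)
  ultimately have "reach G (- S) (f m) (last q)"
    using upath_reach[of G "f m # s" "- S"] by (simp add: s)
  then show False using S(2) q(3) by blast
qed

text \<open>All of \<open>P\<close> lies in one component outside the tree, so a tree vertex linked
  to any vertex of \<open>P\<close> is also linked to \<open>last P\<close> and by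
  \<open>above\<close> lies on the root path \<open>t\<close>. Hence it is comparable with every new
  vertex.\<close>

lemma add_path:
  assumes t: "t \<in> A" and P: "upath G (last t # P)" "P \<noteq> []" "set P \<inter> last ` A = {}"
    and above: "\<And>p. p \<in> A \<Longrightarrow> linked G (last ` A) (last p) (last P) \<Longrightarrow> prefix p t"
  shows "normal_paths (A \<union> {t @ c |c. c \<noteq> [] \<and> prefix c P}) r G"
proof -
  let ?N = "{t @ c |c. c \<noteq> [] \<and> prefix c P}"
  let ?B = "A \<union> ?N"
  have lastN: "last p \<in> set P" if "p \<in> ?N" for p
    using that by (auto simp: prefix_def)
  have disj: "last p \<notin> last ` A" if "p \<in> ?N" for p
    using lastN[OF that] P(3) by blast
  have dP: "distinct P" using P(1) by (simp add: upath_def)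
  have old_new: "prefix p q"
    if p: "p \<in> A" "q \<in> ?N" "linked G (last ` ?B) (last p) (last q)" for p q
  proof -
    obtain c d where c: "q = t @ c" "c \<noteq> []" "P = c @ d" using p(2) by (auto simp: prefix_def)
    have "P = butlast c @ last c # d" using c by simp
    then have "upath G (last c # d)"
      using P(1) upath_appendD2[of G "last t # butlast c" "last c # d"] by simp
    then have "reach G (set P) (last c) (last P)"
      using upath_reach[of G "last c # d" "set P"] c by (auto simp: last_append)
    moreover have "linked G (last ` A) (last p) (last c)"
      using linked_antimono[OF p(3), of "last ` A"] c by auto
    ultimately have "linked G (last ` A) (last p) (last P)" using linked_reach P(3) by metis
    then have "prefix p t" using above p(1) by blast
    then show ?thesis using c(1) by simp
  qed
  show ?thesis
  proof
    show "[r] \<in> ?B" using root by simp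
    show "p \<noteq> []" "hd p = r" if "p \<in> ?B" for p
      using that nonempty hd_root t by auto
    show "r \<in> verts G" "ugraph G" by (fact root_vert graph)+
    show "p \<in> ?B" if px: "p @ [x] \<in> ?B" "p \<noteq> []" for p x
    proof (cases "p @ [x] \<in> A")
      case True
      then show ?thesis using px butlast_closed by blast
    next
      case False
      then obtain c where c: "p @ [x] = t @ c" "c \<noteq> []" "prefix c P" using px by blast
      then obtain c' where c': "c = c' @ [x]" by (cases c rule: rev_cases) auto
      then have "p = t @ c'" "prefix c' P" using c by (auto simp: prefix_def)
      then show ?thesis using t by (cases "c' = []") auto
    qed
    show "adj G (last p) x" if px: "p @ [x] \<in> ?B" "p \<noteq> []" for p x
    proof (cases "p @ [x] \<in> A")
      case True
      then show ?thesis using px adj_path by blast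
    next
      case False
      then obtain c where c: "p @ [x] = t @ c" "c \<noteq> []" "prefix c P" using px by blast
      then obtain c' where c': "c = c' @ [x]" by (cases c rule: rev_cases) auto
      then obtain d where d: "P = c' @ x # d" using c by (auto simp: prefix_def)
      have "p = t @ c'" using c c' by simp
      then have "last p = last (last t # c')" using nonempty[OF t] by (auto simp: last_append)
      then show ?thesis using P(1) unfolding d upath_def
        by (auto simp: successively_append_iff successively_Cons split: if_splits)
    qed
    show "inj_on last ?B"
    proof (rule inj_onI)
      fix p q assume pq: "p \<in> ?B" "q \<in> ?B" "last p = last q"
      have "q' \<in> A" if "p' \<in> A" "q' \<in> ?B" "last p' = last q'" for p' q'
      proof (rule ccontr)
        assume "q' \<notin> A"
        then have "q' \<in> ?N" using that(2) by blast
        from disj[OF this] show False using that(1,3) by (metis imageI)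
      qed
      then consider "p \<in> A" "q \<in> A" | "p \<in> ?N" "q \<in> ?N" using pq by fastforce
      then show "p = q"
      proof cases
        case 1
        then show ?thesis using pq last_eqD by blast
      next
        case 2
        then obtain c c' where "p = t @ c" "q = t @ c'" "c \<noteq> []" "c' \<noteq> []"
          "prefix c P" "prefix c' P" by blast
        moreover then obtain d d' where "P = c @ d" "P = c' @ d'" unfolding prefix_def by blast
        ultimately have e: "p = t @ c" "q = t @ c'" "c \<noteq> []" "c' \<noteq> []" "P = c @ d" "P = c' @ d'"
          by blast+
        then obtain a x a' where a: "c = a @ [x]" "c' = a' @ [x]"
          using pq(3) by (cases c rule: rev_cases; cases c' rule: rev_cases) auto
        then have "distinct (a @ x # d)" using e dP by auto
        then have "x \<notin> set a" "x \<notin> set d" by simp_all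
        moreover have "a @ x # d = a' @ x # d'" using a e by auto
        ultimately have "a = a'" using append_Cons_eq_iff[of x a d a' d'] by blast
        then show ?thesis using e a by simp
      qed
    qed
    show "prefix p q \<or> prefix q p"
      if pq: "p \<in> ?B" "q \<in> ?B" "linked G (last ` ?B) (last p) (last q)" for p q
    proof -
      consider "p \<in> A" "q \<in> A" | "p \<in> ?N" "q \<in> ?N" | "p \<in> A" "q \<in> ?N" | "p \<in> ?N" "q \<in> A"
        using pq by blast
      then show ?thesis
      proof cases
        case 1
        moreover have "linked G (last ` A) (last p) (last q)"
          by (rule linked_antimono[OF pq(3)]) auto
        ultimately show ?thesis using normal by blast
      next
        case 2
        then obtain c c' where "p = t @ c" "q = t @ c'" "prefix c P" "prefix c' P" by blast
        then show ?thesis using prefix_same_cases[of c P c'] by simp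
      next
        case 3
        then show ?thesis using old_new[OF _ _ pq(3)] by simp
      next
        case 4
        then show ?thesis using old_new[OF _ _ linked_sym[OF pq(3)]] by simp
      qed
    qed
  qed
qed

end

text \<open>Any two paths of the union lie in a common member of the chain, and a walk avoiding the
  vertices of the union avoids those of that member, so each condition is checked inside a single
  member.\<close>

lemma normal_paths_Union:
  assumes "C \<noteq> {}" "\<And>A. A \<in> C \<Longrightarrow> normal_paths A r G"
    and chain: "\<And>A B. A \<in> C \<Longrightarrow> B \<in> C \<Longrightarrow> A \<subseteq> B \<or> B \<subseteq> A"
  shows "normal_paths (\<Union> C) r G"
proof -
  obtain A where A: "A \<in> C" using assms(1) by blast
  interpret normal_paths A r G by (rule assms(2)[OF A])
  have both: "\<exists>B\<in>C. p \<in> B \<and> q \<in> B" if "p \<in> \<Union> C" "q \<in> \<Union> C" for p q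
    using that chain by blast
  have rp: "root_paths B r" if "B \<in> C" for B
    using assms(2)[OF that] by (simp add: normal_paths_def)
  show ?thesis
  proof
    show "[r] \<in> \<Union> C" using A root by blast
    show "r \<in> verts G" "ugraph G" by (fact root_vert graph)+
    show "p \<noteq> []" "hd p = r" if "p \<in> \<Union> C" for p
      using that root_paths.nonempty[OF rp] root_paths.hd_root[OF rp] by blast+
    show "p \<in> \<Union> C" if "p @ [x] \<in> \<Union> C" "p \<noteq> []" for p x
      using that root_paths.butlast_closed[OF rp] by blast
    show "adj G (last p) x" if "p @ [x] \<in> \<Union> C" "p \<noteq> []" for p x
      using that normal_paths.adj_path[OF assms(2)] by blast
    show "inj_on last (\<Union> C)"
    proof (rule inj_onI)
      fix p q assume pq: "p \<in> \<Union> C" "q \<in> \<Union> C" "last p = last q"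
      then obtain B where "B \<in> C" "p \<in> B" "q \<in> B" using both by blast
      then show "p = q" using root_paths.last_eqD[OF rp] pq(3) by blast
    qed
    show "prefix p q \<or> prefix q p"
      if pq: "p \<in> \<Union> C" "q \<in> \<Union> C" "linked G (last ` \<Union> C) (last p) (last q)" for p q
    proof -
      obtain B where B: "B \<in> C" "p \<in> B" "q \<in> B" using both pq by blast
      then have "linked G (last ` B) (last p) (last q)"
        by (intro linked_antimono[OF pq(3)]) auto
      then show ?thesis using normal_paths.normal[OF assms(2)] B by blast
    qed
  qed
qed

text \<open>Suppose a Zorn-maximal tree \<open>M\<close> misses \<open>u\<close> in
  \<open>U\<close>. By normality the tree vertices linked to \<open>u\<close> form a chain, which is
  bounded by \<open>chain_bounded\<close>, and \<open>add_path\<close> attaches a path from its top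
  \<open>t\<close> to \<open>u\<close>. The new vertices lie below \<open>u\<close>, so the
  invariant on \<open>U\<close> survives, contrary to maximality.\<close>

lemma extend_to_dispersed:
  assumes G: "connected_ugraph G" and U: "dispersed G U" "U \<subseteq> verts G"
    and A: "normal_paths A r G" "\<And>p. p \<in> A \<Longrightarrow> \<exists>q\<in>A. prefix p q \<and> last q \<in> U"
  shows "\<exists>B. A \<subseteq> B \<and> normal_paths B r G \<and>
    (\<forall>p\<in>B. \<exists>q\<in>B. prefix p q \<and> last q \<in> U) \<and> U \<subseteq> last ` B"
proof -
  define Z where "Z = {B. A \<subseteq> B \<and> normal_paths B r G \<and> (\<forall>p\<in>B. \<exists>q\<in>B. prefix p q \<and> last q \<in> U)}"
  have "\<exists>M\<in>Z. \<forall>B\<in>Z. M \<subseteq> B \<longrightarrow> B = M"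
  proof (rule subset_Zorn_nonempty)
    show "Z \<noteq> {}" using A by (auto simp: Z_def)
    fix C assume C: "C \<noteq> {}" "subset.chain Z C"
    then have sub: "C \<subseteq> Z" by (simp add: subset_chain_def)
    then have "normal_paths (\<Union> C) r G"
      using C by (intro normal_paths_Union) (auto simp: subset_chain_def Z_def)
    moreover have "A \<subseteq> \<Union> C" using C(1) sub by (auto simp: Z_def)
    moreover have "\<exists>q\<in>\<Union> C. prefix p q \<and> last q \<in> U" if "p \<in> \<Union> C" for p
      using that sub unfolding Z_def by blast
    ultimately show "\<Union> C \<in> Z" by (auto simp: Z_def)
  qed
  then obtain M where M: "M \<in> Z" and max: "\<And>B. B \<in> Z \<Longrightarrow> M \<subseteq> B \<Longrightarrow> B = M" by blast
  have down: "\<And>p. p \<in> M \<Longrightarrow> \<exists>q\<in>M. prefix p q \<and> last q \<in> U" using M by (auto simp: Z_def)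
  interpret M: normal_paths M r G using M by (simp add: Z_def)
  let ?W = "last ` M"
  have "u \<in> ?W" if u: "u \<in> U" for u
  proof (rule ccontr)
    assume nu: "u \<notin> ?W"
    define N where "N = {p\<in>M. linked G ?W (last p) u}"
    have r: "r \<in> ?W" using M.root by force
    have chain: "prefix p q \<or> prefix q p" if "p \<in> N" "q \<in> N" for p q
    proof (rule M.normal)
      show "p \<in> M" "q \<in> M" using that by (simp_all add: N_def)
      have "linked G ?W (last p) u" "linked G ?W u (last q)"
        using that linked_sym by (auto simp: N_def)
      then show "linked G ?W (last p) (last q)" using linked_trans nu by metis
    qed
    have "reach G (verts G) r u" using connected_reach[OF G] M.root_vert u U(2) by blast
    then have "N \<noteq> {}" using linked_from[OF _ r nu] by (auto simp: N_def)
    then obtain p0 where p0: "p0 \<in> N" by blast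
    have "N \<subseteq> M" by (auto simp: N_def)
    from M.chain_bounded[OF U(1) down this chain]
    obtain n where "\<forall>p\<in>N. length p \<le> n" by blast
    then have "\<forall>p. p \<in> N \<longrightarrow> length p < Suc n" by (simp add: less_Suc_eq_le)
    from arg_max_nat_lemma[of "\<lambda>p. p \<in> N", OF p0 this]
    obtain t where t: "t \<in> N" "\<And>p. p \<in> N \<Longrightarrow> length p \<le> length t" by blast
    have tM: "t \<in> M" "linked G ?W (last t) u" using t by (auto simp: N_def)
    have "last t \<noteq> u" using nu tM by blast
    then obtain s where s: "upath G (last t # s @ [u])" "set s \<inter> ?W = {}"
      using linked_upath[OF M.graph _ tM(2)] tM(1) by blast
    have above: "prefix p t" if "p \<in> M" "linked G ?W (last p) u" for p
    proof -
      have p: "p \<in> N" using that by (simp add: N_def)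
      from chain[OF p t(1)] t(2)[OF p] show ?thesis by (auto simp: prefix_def)
    qed
    let ?B = "M \<union> {t @ c |c. c \<noteq> [] \<and> prefix c (s @ [u])}"
    have "normal_paths ?B r G"
      using s nu above by (intro M.add_path tM) auto
    moreover have tu: "t @ s @ [u] \<in> ?B" by blast
    moreover have "\<exists>q\<in>?B. prefix p q \<and> last q \<in> U" if "p \<in> ?B" for p
    proof (cases "p \<in> M")
      case True
      then show ?thesis using down by blast
    next
      case False
      then have "prefix p (t @ s @ [u])" using that by auto
      then show ?thesis using tu u by (intro bexI[of _ "t @ s @ [u]"]) auto
    qed
    ultimately have "?B \<in> Z" using M unfolding Z_def by blast
    then have "?B = M" using max by blast
    then have "t @ s @ [u] \<in> M" using tu by blast
    then show False using nu by force
  qed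
  then show ?thesis using M by (intro exI[of _ M]) (auto simp: Z_def)
qed

lemma normal_paths_singleton:
  "ugraph G \<Longrightarrow> r \<in> verts G \<Longrightarrow> normal_paths {[r]} r G"
  by unfold_locales auto

lemma normally_spanned_Un:
  assumes G: "connected_ugraph G" and "normally_spanned G X" "normally_spanned G Y"
  shows "normally_spanned G (X \<union> Y)"
proof -
  obtain A r B r' where A: "normal_paths A r G" "X \<subseteq> last ` A"
    and B: "normal_paths B r' G" "Y \<subseteq> last ` B"
    and XY: "X \<union> Y \<subseteq> verts G"
    using assms(2,3) by (auto simp: normally_spanned_iff)
  interpret A: normal_paths A r G by (rule A)
  interpret B: normal_paths B r' G by (rule B)
  \<comment> \<open>\<open>Suc n\<close> for \<open>A\<close> puts the root \<open>r\<close> into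
    \<open>U 0\<close>, so that the one-vertex tree satisfies the invariant at the start;
    \<open>B\<close> need not be rooted at \<open>r\<close>.\<close>
  define U where "U n = {last p |p. p \<in> A \<and> length p \<le> Suc n} \<union> {last p |p. p \<in> B \<and> length p \<le> n}" for n
  have disp: "dispersed G (U n)" for n
    unfolding U_def by (rule dispersed_Un[OF A.dispersed_levels B.dispersed_levels])
  have U_verts: "U n \<subseteq> verts G" for n
    using A.verts_subset B.verts_subset by (auto simp: U_def)
  have U_Suc: "U n \<subseteq> U (Suc n)" for n
    by (auto simp: U_def)
  have "\<exists>p. r = last p \<and> p \<in> A \<and> length p \<le> Suc 0"
    using A.root by (intro exI[of _ "[r]"]) auto
  then have r: "r \<in> U 0" by (simp add: U_def)
  note extend = extend_to_dispersed[OF G disp U_verts]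
  define P where "P n C \<longleftrightarrow> normal_paths C r G \<and>
    (\<forall>p\<in>C. \<exists>q\<in>C. prefix p q \<and> last q \<in> U n) \<and> U n \<subseteq> last ` C" for n C
  have "\<exists>C. P 0 C"
    using extend[OF normal_paths_singleton[OF A.graph A.root_vert], of 0] r
    unfolding P_def by auto
  moreover have "\<exists>D. P (Suc n) D \<and> C \<subseteq> D" if "P n C" for n C
  proof -
    \<comment> \<open>The sets \<open>U n\<close> increase, so the invariant for one of them serves
      for the next.\<close>
    have down: "\<exists>q\<in>C. prefix p q \<and> last q \<in> U (Suc n)" if "p \<in> C" for p
      using that \<open>P n C\<close> U_Suc[of n] unfolding P_def by blast
    have "normal_paths C r G" using \<open>P n C\<close> by (simp add: P_def)
    then obtain D where "C \<subseteq> D" "normal_paths D r G"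
      "\<forall>p\<in>D. \<exists>q\<in>D. prefix p q \<and> last q \<in> U (Suc n)" "U (Suc n) \<subseteq> last ` D"
      using extend[OF _ down] by metis
    then show ?thesis unfolding P_def by blast
  qed
  ultimately obtain F where F: "\<And>n. P n (F n)" "\<And>n. F n \<subseteq> F (Suc n)"
    using dependent_nat_choice[of P "\<lambda>_ C D. C \<subseteq> D"] by metis
  have "mono F" using F(2) by (simp add: mono_iff_le_Suc)
  then have "F m \<subseteq> F n \<or> F n \<subseteq> F m" for m n by (meson le_cases monoD)
  then have "normal_paths (\<Union> (range F)) r G"
    using F(1) by (intro normal_paths_Union) (auto simp: P_def)
  moreover have "X \<union> Y \<subseteq> last ` \<Union> (range F)"
  proof
    fix x assume "x \<in> X \<union> Y"
    then obtain p where p: "p \<in> A \<or> p \<in> B" "x = last p" using A(2) B(2) by blast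
    then have "x \<in> U (length p)" by (auto simp: U_def)
    moreover have "U (length p) \<subseteq> last ` F (length p)" using F(1) by (simp add: P_def)
    ultimately show "x \<in> last ` \<Union> (range F)" by blast
  qed
  ultimately show ?thesis using XY by (auto simp: normally_spanned_iff)
qed


section \<open>Components of induced subgraphs\<close>

definition induce :: "'v ugraph \<Rightarrow> 'v set \<Rightarrow> 'v ugraph" where
  "induce G A = \<lparr>verts = A, edges = {e \<in> edges G. e \<subseteq> A}\<rparr>"

text \<open>Vertex sets instead of subgraphs: every graph that the rank recursion meets from
  \<open>G\<close> on is induced, and \<open>ucomponents_induce\<close> translates.\<close>

definition comps :: "'v ugraph \<Rightarrow> 'v set \<Rightarrow> 'v set set" where
  "comps G A = {{y. reach G A x y} |x. x \<in> A}"

lemma verts_induce [simp]: "verts (induce G A) = A"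
  by (simp add: induce_def)

lemma adj_induce: "adj (induce G A) x y \<longleftrightarrow> adj G x y \<and> x \<in> A \<and> y \<in> A"
  by (auto simp: adj_def induce_def)

lemma delete_verts_induce: "delete_verts (induce G A) X = induce G (A - X)"
  by (auto simp: delete_verts_def induce_def)

lemma induce_verts: "ugraph G \<Longrightarrow> induce G (verts G) = G"
  by (intro ugraph.equality) (auto simp: induce_def ugraph_def)

lemma ugraph_induce: "ugraph G \<Longrightarrow> ugraph (induce G A)"
  by (fastforce simp: ugraph_def induce_def)

lemma comps_eqI:
  assumes "C \<in> comps G A" "x \<in> C"
  shows "C = {y. reach G A x y}"
  using assms unfolding comps_def by (auto intro: reach_trans reach_sym)

lemma comps_disjoint: "C \<in> comps G A \<Longrightarrow> D \<in> comps G A \<Longrightarrow> x \<in> C \<Longrightarrow> x \<in> D \<Longrightarrow> C = D"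
  using comps_eqI by metis

lemma comps_subset: "C \<in> comps G A \<Longrightarrow> C \<subseteq> A"
  unfolding comps_def by (auto dest: reach_mem)

lemma comps_nonempty: "C \<in> comps G A \<Longrightarrow> C \<noteq> {}"
  unfolding comps_def by (auto intro: reach.refl)

lemma comps_cover: "x \<in> A \<Longrightarrow> \<exists>C\<in>comps G A. x \<in> C"
  unfolding comps_def by (auto intro: reach.refl)

lemma comps_adj:
  assumes "C \<in> comps G A" "x \<in> C" "adj G x y" "y \<in> A"
  shows "y \<in> C"
  using comps_eqI[OF assms(1,2)] comps_subset[OF assms(1)] assms(2-4) by (auto intro: reach_adj)

text \<open>Supplies maximality in \<open>ucomponents_induce\<close>: a connected subgraph cannot
  leave the set of vertices reachable from one of its own.\<close>

lemma connected_subgraph_subset: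
  assumes "subgraph_of D (induce G A)" "connected_ugraph D" "x \<in> verts D"
  shows "subgraph_of D (induce G {y. reach G A x y})"
proof -
  let ?B = "{y. reach G A x y}"
  have D: "ugraph D" "ugraph (induce G A)" "verts D \<subseteq> A" "edges D \<subseteq> edges (induce G A)"
    using assms(1) by (auto simp: subgraph_of_def)
  have "reach D (verts D) x y \<Longrightarrow> reach G A x y" for y
  proof (induction rule: reach.induct)
    case refl
    then show ?case using D by (auto intro: reach.intros)
  next
    case (step y z)
    then have "adj G y z" "z \<in> A" using D by (auto simp: adj_def induce_def)
    then show ?case using step.IH by (blast intro: reach.step)
  qed
  then have v: "verts D \<subseteq> ?B" using connected_reach[OF assms(2,3)] by blast
  moreover have "edges D \<subseteq> edges (induce G ?B)"
  proof
    fix e assume e: "e \<in> edges D"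
    then have "e \<subseteq> verts D" using D(1) by (auto simp: ugraph_def)
    then show "e \<in> edges (induce G ?B)" using e D(4) v by (auto simp: induce_def)
  qed
  moreover have "ugraph (induce G ?B)"
    unfolding ugraph_def
  proof
    fix e assume e: "e \<in> edges (induce G ?B)"
    then have "e \<subseteq> ?B" "e \<in> edges (induce G A)"
      by (auto simp: induce_def dest: reach_mem)
    then show "\<exists>u\<in>verts (induce G ?B). \<exists>v\<in>verts (induce G ?B). u \<noteq> v \<and> e = {u, v}"
      using D(2) unfolding ugraph_def by fastforce
  qed
  ultimately show ?thesis using D(1) by (simp add: subgraph_of_def)
qed

lemma connected_induce_comps:
  assumes "ugraph G" "C \<in> comps G A"
  shows "connected_ugraph (induce G C)"
proof -
  obtain x where x: "x \<in> A" "C = {y. reach G A x y}" using assms(2) by (auto simp: comps_def)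
  have from_x: "reach (induce G C) C x y" if "reach G A x y" for y
    using that
  proof (induction rule: reach.induct)
    case refl
    then show ?case using x by (auto intro: reach.intros)
  next
    case (step y z)
    then have "y \<in> C" "z \<in> C" using reach.step[of G A x y z] by (auto simp: x(2))
    then show ?case using step by (auto simp: adj_induce intro: reach.step)
  qed
  have "\<exists>p. upath_between (induce G C) u p v" if "u \<in> C" "v \<in> C" for u v
  proof -
    have "reach (induce G C) C u v"
      using that from_x reach_trans reach_sym unfolding x(2) by (metis mem_Collect_eq)
    then show ?thesis using reach_upath[of "induce G C" C u v] by auto
  qed
  then show ?thesis
    using ugraph_induce[OF assms(1)] comps_nonempty[OF assms(2)] by (auto simp: connected_ugraph_def)
qed

lemma subgraph_of_antisym: "subgraph_of C D \<Longrightarrow> subgraph_of D C \<Longrightarrow> C = D"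
  by (intro ugraph.equality) (auto simp: subgraph_of_def)

lemma induce_mono: "ugraph G \<Longrightarrow> A \<subseteq> B \<Longrightarrow> subgraph_of (induce G A) (induce G B)"
  using ugraph_induce by (auto simp: subgraph_of_def induce_def)

lemma ucomponents_induce:
  assumes G: "ugraph G"
  shows "ucomponents (induce G A) = induce G ` comps G A"
proof (intro equalityI subsetI)
  fix C assume "C \<in> ucomponents (induce G A)"
  then have C: "subgraph_of C (induce G A)" "connected_ugraph C"
    and max: "\<And>D. subgraph_of D (induce G A) \<Longrightarrow> connected_ugraph D \<Longrightarrow> subgraph_of C D \<Longrightarrow> D = C"
    by (auto simp: ucomponents_def)
  obtain x where x: "x \<in> verts C" using C(2) by (auto simp: connected_ugraph_def)
  let ?B = "{y. reach G A x y}"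
  have B: "?B \<in> comps G A" using x C(1) by (auto simp: comps_def subgraph_of_def)
  have "subgraph_of C (induce G ?B)" by (rule connected_subgraph_subset[OF C x])
  then have "induce G ?B = C"
    using max connected_induce_comps[OF G B] induce_mono[OF G comps_subset[OF B]] by blast
  then show "C \<in> induce G ` comps G A" using B by blast
next
  fix C assume "C \<in> induce G ` comps G A"
  then obtain B where B: "B \<in> comps G A" "C = induce G B" by blast
  have C: "connected_ugraph C" "subgraph_of C (induce G A)"
    using connected_induce_comps[OF G B(1)] induce_mono[OF G comps_subset[OF B(1)]] B(2) by auto
  have "D = C"
    if D: "subgraph_of D (induce G A)" "connected_ugraph D" "subgraph_of C D" for D
  proof -
    obtain x where x: "x \<in> B" using comps_nonempty[OF B(1)] by blast
    then have "x \<in> verts D" using D(3) B(2) by (auto simp: subgraph_of_def)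
    then have "subgraph_of D C"
      using connected_subgraph_subset[OF D(1,2)] comps_eqI[OF B(1) x] B(2) by simp
    then show ?thesis using D(3) subgraph_of_antisym by blast
  qed
  then show "C \<in> ucomponents (induce G A)" using C by (auto simp: ucomponents_def)
qed


section \<open>Normal ranks of induced subgraphs\<close>

unbundle cardinal_syntax

lemma normally_spanned_subset: "normally_spanned G U \<Longrightarrow> U' \<subseteq> U \<Longrightarrow> normally_spanned G U'"
  by (auto simp: normally_spanned_def)

lemma not_ordLess_empty: "\<not> r <o {}"
proof
  assume *: "r <o {}"
  then have "Well_order r" "Well_order {}" by (auto simp: ordLess_def)
  then show False using * by (auto simp: ordLess_iff_ordIso_Restr)
qed

definition rank_in :: "'v ugraph \<Rightarrow> 'o rel \<Rightarrow> 'v set \<Rightarrow> bool" where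
  "rank_in G \<alpha> A \<longleftrightarrow> has_normal_rank_in G \<alpha> (induce G A)"

lemma rank_in_iff:
  fixes \<alpha> :: "'o rel"
  assumes "ugraph G"
  shows "rank_in G \<alpha> A \<longleftrightarrow> Well_order \<alpha> \<and>
    (if \<alpha> = {} then normally_spanned G A
     else (\<forall>\<beta> :: 'o rel. \<beta> <o \<alpha> \<longrightarrow> \<not> rank_in G \<beta> A) \<and>
       (\<exists>X. normally_spanned G X \<and>
          (\<forall>C\<in>comps G (A - X). \<exists>\<beta> :: 'o rel. \<beta> <o \<alpha> \<and> rank_in G \<beta> C)))"
  unfolding rank_in_def
  by (subst has_normal_rank_in.simps) (auto simp: delete_verts_induce ucomponents_induce[OF assms])

text \<open>Ranks are minimal by definition, which is awkward to establish. Here an upper bound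
  suffices: either a smaller rank exists, or the minimality clause holds for \<open>\<alpha>\<close>
  itself.\<close>

lemma rank_in_le:
  fixes \<alpha> :: "'o rel"
  assumes G: "ugraph G" and \<alpha>: "Well_order \<alpha>" and X: "normally_spanned G X"
    and C: "\<And>C. C \<in> comps G (A - X) \<Longrightarrow> \<exists>\<beta> :: 'o rel. \<beta> <o \<alpha> \<and> rank_in G \<beta> C"
  shows "\<exists>\<beta> :: 'o rel. \<beta> \<le>o \<alpha> \<and> rank_in G \<beta> A"
proof (cases "\<exists>\<beta> :: 'o rel. \<beta> <o \<alpha> \<and> rank_in G \<beta> A")
  case True
  then show ?thesis using ordLess_imp_ordLeq by blast
next
  case False
  have "rank_in G \<alpha> A"
  proof (cases "\<alpha> = {}")
    case True
    \<comment> \<open>No ordinal precedes \<open>0\<close>, so no component is left and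
      \<open>X\<close> covers \<open>A\<close>.\<close>
    then have "comps G (A - X) = {}" using C not_ordLess_empty by blast
    then have "A \<subseteq> X" using comps_cover[of _ "A - X" G] by blast
    then have "normally_spanned G A" using normally_spanned_subset[OF X] by blast
    then show ?thesis by (subst rank_in_iff[OF G]) (use True \<alpha> in simp)
  next
    case nonempty: False
    show ?thesis
      by (subst rank_in_iff[OF G]) (use False C X \<alpha> nonempty in auto)
  qed
  then show ?thesis using ordLeq_reflexive[OF \<alpha>] by blast
qed

text \<open>By symmetry, ranks are unique up to isomorphism; this lets a chosen rank be compared
  with any other rank of the same set.\<close>

lemma rank_in_ordLeq:
  fixes \<alpha> \<beta> :: "'o rel"
  assumes G: "ugraph G" and "rank_in G \<alpha> A" "rank_in G \<beta> A"
  shows "\<alpha> \<le>o \<beta>"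
proof -
  have wo: "Well_order \<alpha>" "Well_order \<beta>"
    using assms(2,3) rank_in_iff[OF G] by metis+
  have "\<not> \<beta> <o \<alpha>"
  proof
    assume "\<beta> <o \<alpha>"
    moreover then have "\<alpha> \<noteq> {}" using not_ordLess_empty by blast
    ultimately show False using assms(2,3) rank_in_iff[OF G, of \<alpha> A] by (metis (full_types))
  qed
  then show ?thesis using wo not_ordLess_iff_ordLeq by blast
qed

text \<open>Makes rank \<open>0\<close> uniform with the other ranks: there, deleting
  \<open>A\<close> itself leaves no component.\<close>

lemma rank_in_step:
  fixes \<alpha> :: "'o rel"
  assumes G: "ugraph G" and "rank_in G \<alpha> A"
  shows "\<exists>X. normally_spanned G X \<and>
    (\<forall>C\<in>comps G (A - X). \<exists>\<beta> :: 'o rel. \<beta> <o \<alpha> \<and> rank_in G \<beta> C)"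
proof (cases "\<alpha> = {}")
  case True
  then have "normally_spanned G A" using assms(2) rank_in_iff[OF G, of \<alpha> A] by simp
  moreover have "comps G (A - A) = {}" by (simp add: comps_def)
  ultimately show ?thesis by (intro exI[of _ A]) simp
next
  case False
  then show ?thesis using assms(2) rank_in_iff[OF G, of \<alpha> A] by simp
qed

text \<open>Linearising by the rank of a well-founded relation, with ties broken by an arbitrary well-order.\<close>

inductive rank_le :: "'a rel \<Rightarrow> 'a \<Rightarrow> 'a \<Rightarrow> bool" for R where
  "(\<And>x'. (x', x) \<in> R \<Longrightarrow> \<exists>y'. (y', y) \<in> R \<and> rank_le R x' y') \<Longrightarrow> rank_le R x y"

lemma rank_le_trans: "rank_le R x y \<Longrightarrow> rank_le R y z \<Longrightarrow> rank_le R x z"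
proof (induction arbitrary: z rule: rank_le.induct)
  case (1 x y)
  show ?case
  proof (rule rank_le.intros)
    fix x' assume "(x', x) \<in> R"
    then obtain y' where y': "(y', y) \<in> R" "\<And>z. rank_le R y' z \<Longrightarrow> rank_le R x' z"
      using 1(1) by blast
    obtain z' where "(z', z) \<in> R" "rank_le R y' z'" using 1(2) y'(1) rank_le.cases by metis
    then show "\<exists>z'. (z', z) \<in> R \<and> rank_le R x' z'" using y'(2) by blast
  qed
qed

lemma rank_le_total: "wf R \<Longrightarrow> rank_le R x y \<or> rank_le R y x"
proof (induction x arbitrary: y rule: wf_induct_rule)
  case (less x)
  show ?case
  proof (cases "rank_le R x y")
    case False
    then obtain x' where x': "(x', x) \<in> R" "\<And>y'. (y', y) \<in> R \<Longrightarrow> \<not> rank_le R x' y'"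
      using rank_le.intros by metis
    have "rank_le R y x"
    proof (rule rank_le.intros)
      fix y' assume "(y', y) \<in> R"
      then have "rank_le R y' x'" using x'(2) less.IH[OF x'(1), of y'] less.prems by blast
      then show "\<exists>x'. (x', x) \<in> R \<and> rank_le R y' x'" using x'(1) by blast
    qed
    then show ?thesis by blast
  qed simp
qed

lemma not_rank_le: "wf R \<Longrightarrow> (x', x) \<in> R \<Longrightarrow> \<not> rank_le R x x'"
proof (induction x arbitrary: x' rule: wf_induct_rule)
  case (less x)
  then show ?case using rank_le.cases by metis
qed

lemma not_rank_leD: "wf R \<Longrightarrow> \<not> rank_le R x y \<Longrightarrow> \<exists>x'. (x', x) \<in> R \<and> rank_le R y x'"
proof (induction x arbitrary: y rule: wf_induct_rule)
  case (less x)
  then obtain x' where x': "(x', x) \<in> R" "\<And>y'. (y', y) \<in> R \<Longrightarrow> \<not> rank_le R x' y'"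
    using rank_le.intros by metis
  have "rank_le R y x'"
    by (rule rank_le.intros) (rule less.IH[OF x'(1) x'(2)])
  then show ?case using x'(1) by blast
qed

text \<open>The bound \<open>x\<close> carries the induction: a member of \<open>Q\<close> that
  ranks below \<open>q\<close> need not precede \<open>q\<close> in \<open>R\<close>, but its rank
  is bounded by that of a predecessor of \<open>x\<close>.\<close>

lemma rank_le_minimal:
  assumes "wf R"
  shows "q \<in> Q \<Longrightarrow> rank_le R q x \<Longrightarrow> \<exists>m\<in>Q. \<forall>y\<in>Q. rank_le R m y"
  using assms
proof (induction x arbitrary: q rule: wf_induct_rule)
  case (less x)
  show ?case
  proof (cases "\<forall>y\<in>Q. rank_le R q y")
    case True
    then show ?thesis using less.prems(1) by (rule bexI)
  next
    case False
    then obtain z where z: "z \<in> Q" "\<not> rank_le R q z" by blast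
    obtain q' where q': "(q', q) \<in> R" "rank_le R z q'" using not_rank_leD[OF assms z(2)] by blast
    obtain x' where x': "(x', x) \<in> R" "rank_le R q' x'"
      using less.prems(2) q'(1) by (auto elim: rank_le.cases)
    show ?thesis by (rule less.IH[OF x'(1) z(1) rank_le_trans[OF q'(2) x'(2)]])
  qed
qed

text \<open>The well-order lives on the type of \<open>R\<close> itself, so a well-founded relation
  on vertex sets yields ordinals represented on \<open>'v set\<close>.\<close>

lemma wf_linearise:
  fixes R :: "'a rel"
  assumes R: "wf R"
  shows "\<exists>W :: 'a rel. Well_order W \<and> Field W = UNIV \<and> R \<subseteq> W - Id"
proof -
  obtain w :: "'a rel" where w: "Well_order w" "Field w = UNIV"
    using well_ordering[where 'a = 'a] by (elim exE conjE)
  define W where "W = {(x, y). rank_le R x y \<and> (rank_le R y x \<longrightarrow> (x, y) \<in> w)}"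
  note total = rank_le_total[OF R] and w' = w(1)[unfolded order_on_defs w(2)]
  have "(x, x) \<in> W" for x
    using total[of x x] w' by (simp add: W_def refl_on_def)
  then have F: "Field W = UNIV" and refl: "refl W"
    by (auto simp: Field_def refl_on_def)
  have "trans W"
  proof (rule transI)
    fix x y z assume xy: "(x, y) \<in> W" "(y, z) \<in> W"
    then have "rank_le R x z" using rank_le_trans[of R x y z] by (simp add: W_def)
    moreover have "(x, z) \<in> w" if zx: "rank_le R z x"
    proof -
      have "rank_le R y x" "rank_le R z y"
        using xy zx rank_le_trans[of R y z x] rank_le_trans[of R z x y] by (simp_all add: W_def)
      then have "(x, y) \<in> w" "(y, z) \<in> w" using xy by (auto simp: W_def)
      then show ?thesis using w' by (meson transD)
    qed
    ultimately show "(x, z) \<in> W" by (simp add: W_def)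
  qed
  moreover have "antisym W"
    using w' by (auto simp: W_def antisym_def)
  moreover have "total W"
    unfolding total_on_def
  proof (intro ballI impI)
    fix x y :: 'a assume "x \<noteq> y"
    then have "(x, y) \<in> w \<or> (y, x) \<in> w" using w' by (auto simp: total_on_def)
    then show "(x, y) \<in> W \<or> (y, x) \<in> W" using total[of x y] by (auto simp: W_def)
  qed
  moreover have "wf (W - Id)"
  proof (rule wfI_min)
    fix q :: 'a and Q assume "q \<in> Q"
    \<comment> \<open>First a member \<open>m\<close> of least rank, then the \<open>w\<close>-least
      among the members of the same rank.\<close>
    then obtain m where m: "m \<in> Q" "\<And>y. y \<in> Q \<Longrightarrow> rank_le R m y"
      using rank_le_minimal[OF R, of q Q q] total[of q q] by blast
    have "wf (w - Id)" using w' by blast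
    moreover have "m \<in> {q\<in>Q. rank_le R q m}" using m by blast
    ultimately obtain z where z: "z \<in> {q\<in>Q. rank_le R q m}"
      "\<And>y. (y, z) \<in> w - Id \<Longrightarrow> y \<notin> {q\<in>Q. rank_le R q m}"
      by (rule wfE_min) (rule that)
    have "y \<notin> Q" if yz: "(y, z) \<in> W - Id" for y
    proof
      assume y: "y \<in> Q"
      have "rank_le R z y" using z(1) m(2)[OF y] rank_le_trans[of R z m y] by blast
      moreover have "rank_le R y m" using yz z(1) rank_le_trans[of R y z m] by (simp add: W_def)
      ultimately show False using z(2)[of y] yz y by (auto simp: W_def)
    qed
    then show "\<exists>z\<in>Q. \<forall>y. (y, z) \<in> W - Id \<longrightarrow> y \<notin> Q" using z(1) by blast
  qed
  ultimately have "Well_order W"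
    using refl by (simp add: order_on_defs F)
  moreover have "R \<subseteq> W - Id"
    using not_rank_le[OF R] total by (fastforce simp: W_def)
  ultimately show ?thesis using F by blast
qed

text \<open>The strict predecessors of \<open>a\<close> form a proper initial segment of those of
  \<open>b\<close>; \<open>dir_image\<close> only renames along \<open>e\<close>, into the type that
  carries the ordinals.\<close>

lemma initial_segment_ordLess:
  assumes W: "Well_order W" and e: "inj e" and ab: "(a, b) \<in> W" "a \<noteq> b"
  shows "dir_image (Restr W (underS W a)) e <o dir_image (Restr W (underS W b)) e"
proof -
  interpret w: wo_rel W using W by (simp add: wo_rel_def)
  have "a \<in> underS W b" "a \<notin> underS W a" using ab by (auto simp: underS_def)
  moreover have "underS W a \<subseteq> underS W b"
    using ab w.TRANS w.ANTISYM by (auto simp: underS_def dest: transD antisymD)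
  ultimately have "underS W a \<subset> underS W b" by blast
  then have "Restr W (underS W a) <o Restr W (underS W b)"
    using ofilter_subset_ordLess[OF W w.underS_ofilter w.underS_ofilter] by blast
  moreover have iso: "Restr W (underS W c) =o dir_image (Restr W (underS W c)) e" for c
    using e Well_order_Restr[OF W] by (intro dir_image_ordIso) (auto intro: inj_on_subset)
  ultimately show ?thesis
    using ordIso_symmetric ordIso_ordLess_trans ordLess_ordIso_trans by metis
qed


section \<open>From tree-decompositions to ranks\<close>

text \<open>Children count as smaller: an infinite descending sequence climbs the tree, and its
  growing lengths make it a ray.\<close>

lemma (in root_paths) wf_child:
  assumes "\<nexists>f. ray (tree_of A) f"
  shows "wf {(p @ [c], p) |p c. p @ [c] \<in> A \<and> p \<in> A}"
  unfolding wf_iff_no_infinite_down_chain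
proof
  assume "\<exists>g. \<forall>i. (g (Suc i), g i) \<in> {(p @ [c], p) |p c. p @ [c] \<in> A \<and> p \<in> A}"
  then obtain g where g: "\<And>i. \<exists>c. g (Suc i) = g i @ [c]" "\<And>i. g i \<in> A" by blast
  have "length (g i) = length (g 0) + i" for i
  proof (induction i)
    case (Suc i)
    then show ?case using g(1)[of i] by auto
  qed simp
  then have "inj g" by (metis add_left_imp_eq injI)
  then have "inj (\<lambda>i. last (g i))"
    by (intro injI) (rule injD[of g], auto intro: last_eqD g(2))
  moreover have "adj (tree_of A) (last (g i)) (last (g (Suc i)))" for i
    using g(1)[of i] g(2)[of i] g(2)[of "Suc i"] by (auto simp: adj_tree_of)
  ultimately have "ray (tree_of A) (\<lambda>i. last (g i))" using g(2) by (auto simp: ray_def)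
  then show False using assms by blast
qed

locale decomposition = root_paths A r for A :: "'t list set" and r +
  fixes G :: "'v ugraph" and P :: "'t \<Rightarrow> 'v set"
  assumes dec: "tree_decomposition G (tree_of A) P"
begin

definition upper :: "'t list \<Rightarrow> 'v set" where
  "upper p = (\<Union>q\<in>{q\<in>A. prefix p q}. P (last q))"

text \<open>Since \<open>q\<close> is not above the child \<open>p @ [c]\<close>, the meet of
  \<open>q\<close> and \<open>s\<close> is \<open>p\<close> or below it. So the tree path between
  them passes through \<open>p\<close>, and convexity of the decomposition applies.\<close>

lemma parts_separate:
  assumes p: "p \<in> A" and q: "q \<in> A" "\<not> prefix (p @ [c]) q" and s: "s \<in> A" "prefix (p @ [c]) s"
  shows "P (last q) \<inter> P (last s) \<subseteq> P (last p)"
proof -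
  obtain m a b where mab: "q = m @ a" "s = m @ b" "a = [] \<or> b = [] \<or> hd a \<noteq> hd b"
    by (rule list_meet)
  have "q \<noteq> []" "s \<noteq> []" "hd q = hd s" using q s nonempty hd_root by auto
  then have m: "m \<noteq> []" using mab by (cases m) auto
  have "\<not> prefix (p @ [c]) m" using q(2) mab(1) by (auto simp: prefix_def)
  then have "prefix m (p @ [c])" using prefix_same_cases[of m s "p @ [c]"] s(2) mab(2) by auto
  then have "prefix m p" using \<open>\<not> prefix (p @ [c]) m\<close> by (auto simp: prefix_snoc)
  then obtain d where d: "p = m @ d" by (auto simp: prefix_def)
  obtain e where "s = p @ c # e" using s(2) by (auto simp: prefix_def)
  then have "b = d @ c # e" using d mab(2) by simp
  then have "last p \<in> set (rev a @ last m # b)" using d m by (cases d rule: rev_cases) auto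
  then show ?thesis
    using meet_path[OF m _ _ mab(3)] q(1) s(1) mab dec unfolding tree_decomposition_def by metis
qed

text \<open>A walk leaving the parts above the child would do so at a vertex that lies both in such
  a part and in a part elsewhere, hence in \<open>P (last p)\<close>, which has been
  deleted.\<close>

lemma component_above_child:
  assumes p: "p \<in> A" and B: "B \<subseteq> upper p" and C: "C \<in> comps G (B - P (last p))"
  shows "\<exists>c. p @ [c] \<in> A \<and> C \<subseteq> upper (p @ [c])"
proof -
  obtain x where x: "x \<in> B - P (last p)" "C = {y. reach G (B - P (last p)) x y}"
    using C by (auto simp: comps_def)
  obtain q where q: "q \<in> A" "prefix p q" "x \<in> P (last q)"
    using B x(1) by (auto simp: upper_def)
  then have "q \<noteq> p" using x(1) by auto
  then obtain c z where cz: "q = p @ c # z" using q(2) by (metis append.right_neutral list.exhaust prefix_def)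
  then have pc: "p @ [c] \<in> A" using q(1) prefix_closed[of "p @ [c]" z] by simp
  have "y \<in> upper (p @ [c])" if "reach G (B - P (last p)) x y" for y
    using that
  proof (induction rule: reach.induct)
    case refl
    then show ?case using q cz by (auto simp: upper_def)
  next
    case (step y z)
    obtain s where s: "s \<in> A" "prefix (p @ [c]) s" "y \<in> P (last s)"
      using step.IH by (auto simp: upper_def)
    have "{y, z} \<in> edges G" using step.hyps(2) by (simp add: adj_def)
    then obtain t where t: "t \<in> A" "y \<in> P (last t)" "z \<in> P (last t)"
      using dec by (fastforce simp: tree_decomposition_def)
    have "y \<notin> P (last p)" using reach_mem[OF step.hyps(1)] by blast
    then have "prefix (p @ [c]) t" using parts_separate[OF p t(1) _ s(1,2)] s(3) t(2) by blast
    then show ?case using t by (auto simp: upper_def)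
  qed
  then show ?thesis using pc x(2) by blast
qed

lemma upper_root: "upper [r] = verts G"
proof -
  have "prefix [r] q" if "q \<in> A" for q
    using hd_root[OF that] nonempty[OF that] by (cases q) auto
  then have "upper [r] = (\<Union>t\<in>verts (tree_of A). P t)" by (auto simp: upper_def)
  then show ?thesis using dec by (simp add: tree_decomposition_def)
qed

text \<open>
  Each vertex set is sent to a root path \<open>p\<close>, least in a linearisation \<open>L\<close> of the rayless
  tree, above which it lies.  Deleting the part at \<open>p\<close> then makes this path strictly smaller, so
  that pulling \<open>L\<close> back bounds the ranks by initial segments of a well-order of \<open>'v set\<close>.
\<close>

lemma ranks_bounded:
  assumes G: "ugraph G" and noray: "\<nexists>f. ray (tree_of A) f"
    and parts: "\<And>t. t \<in> last ` A \<Longrightarrow> normally_spanned G (P t)"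
    and e: "inj (e :: 'v set \<Rightarrow> 'o)"
  shows "\<exists>\<alpha> :: 'o rel. rank_in G \<alpha> (verts G)"
proof -
  obtain L :: "'t list rel" where L: "Well_order L" "Field L = UNIV"
    "{(p @ [c], p) |p c. p @ [c] \<in> A \<and> p \<in> A} \<subseteq> L - Id"
    using wf_linearise[OF wf_child[OF noray]] by (elim exE conjE)
  have wfL: "wf (L - Id)" and Lo: "refl L" "trans L" "antisym L" "total L"
    using L(1,2) by (auto simp: order_on_defs)
  define least where "least B = (SOME p. p \<in> A \<and> B \<subseteq> upper p \<and>
    (\<forall>q\<in>A. B \<subseteq> upper q \<longrightarrow> (p, q) \<in> L))" for B
  have least: "least B \<in> A" "B \<subseteq> upper (least B)" "\<And>q. q \<in> A \<Longrightarrow> B \<subseteq> upper q \<Longrightarrow> (least B, q) \<in> L"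
    if B: "B \<subseteq> verts G" for B
  proof -
    have "[r] \<in> {p\<in>A. B \<subseteq> upper p}" using root upper_root B by simp
    with wfL obtain p where p: "p \<in> {p\<in>A. B \<subseteq> upper p}"
      "\<And>q. (q, p) \<in> L - Id \<Longrightarrow> q \<notin> {p\<in>A. B \<subseteq> upper p}"
      by (rule wfE_min) (rule that)
    have "(p, q) \<in> L" if "q \<in> A" "B \<subseteq> upper q" for q
    proof -
      have "(q, p) \<notin> L - Id" using p(2)[of q] that by blast
      then show ?thesis using Lo(1,4) by (cases "p = q") (auto simp: refl_on_def total_on_def)
    qed
    then have "\<exists>p. p \<in> A \<and> B \<subseteq> upper p \<and> (\<forall>q\<in>A. B \<subseteq> upper q \<longrightarrow> (p, q) \<in> L)"
      using p(1) by blast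
    from someI_ex[OF this] show "least B \<in> A" "B \<subseteq> upper (least B)"
      "\<And>q. q \<in> A \<Longrightarrow> B \<subseteq> upper q \<Longrightarrow> (least B, q) \<in> L"
      unfolding least_def by blast+
  qed
  have "wf (inv_image (L - Id) least)" using wfL by simp
  from wf_linearise[OF this] obtain W :: "'v set rel"
    where W: "Well_order W" "inv_image (L - Id) least \<subseteq> W - Id"
    by (elim exE conjE)
  define \<alpha> where "\<alpha> B = dir_image (Restr W (underS W B)) e" for B
  have \<alpha>_wo: "Well_order (\<alpha> B)" for B
    unfolding \<alpha>_def using Well_order_Restr[OF W(1)] e by (intro Well_order_dir_image) (auto intro: inj_on_subset)
  have "\<exists>\<beta> :: 'o rel. \<beta> \<le>o \<alpha> B \<and> rank_in G \<beta> B" if "B \<subseteq> verts G" for B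
    using \<open>wf (inv_image (L - Id) least)\<close> that
  proof (induction B rule: wf_induct_rule)
    case (less B)
    note p = least[OF less.prems]
    show ?case
    proof (rule rank_in_le[OF G \<alpha>_wo])
      show "normally_spanned G (P (last (least B)))" using p(1) parts by blast
      fix C assume C: "C \<in> comps G (B - P (last (least B)))"
      then have CV: "C \<subseteq> verts G" using comps_subset less.prems by blast
      obtain c where c: "least B @ [c] \<in> A" "C \<subseteq> upper (least B @ [c])"
        using component_above_child[OF p(1,2) C] by blast
      \<comment> \<open>\<open>C\<close> lies above the child \<open>c\<close>, so its least path is
        at most that child, which precedes \<open>least B\<close> in \<open>L\<close>.\<close>
      then have "(least C, least B @ [c]) \<in> L" using least(3)[OF CV] by blast
      moreover have "(least B @ [c], least B) \<in> L - Id" using L(3) c(1) p(1) by blast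
      ultimately have lt: "(least C, least B) \<in> L - Id"
        using Lo(2,3) by (auto dest: transD antisymD)
      then have "(C, B) \<in> inv_image (L - Id) least" by (simp only: in_inv_image)
      then have "(C, B) \<in> W" "C \<noteq> B" using W(2) by blast+
      then have "\<alpha> C <o \<alpha> B" unfolding \<alpha>_def by (rule initial_segment_ordLess[OF W(1) e])
      moreover obtain \<beta> :: "'o rel" where "\<beta> \<le>o \<alpha> C" "rank_in G \<beta> C"
        using less.IH[of C] lt CV by auto
      ultimately show "\<exists>\<beta> :: 'o rel. \<beta> <o \<alpha> B \<and> rank_in G \<beta> C"
        using ordLeq_ordLess_trans by blast
    qed
  qed
  then show ?thesis by blast
qed

end

lemma normal_rank_if_traceable:
  fixes G :: "'v ugraph" and e :: "'v set \<Rightarrow> 'o"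
  assumes "normally_traceable TYPE('t) G" "inj e"
  shows "has_normal_rank TYPE('o) G"
proof -
  obtain T :: "'t ugraph" and P where G: "connected_ugraph G" and T: "tree_decomposition G T P"
    "\<nexists>f. ray T f" "\<forall>t\<in>verts T. normally_spanned G (P t)"
    using assms(1) by (auto simp: normally_traceable_def)
  have ug: "ugraph G" using G by (simp add: connected_ugraph_def)
  have "utree T" using T(1) by (simp add: tree_decomposition_def)
  moreover then obtain r where "r \<in> verts T" by (auto simp: utree_def connected_ugraph_def)
  ultimately have rp: "root_paths (root_paths_of T r) r" "tree_of (root_paths_of T r) = T"
    by (rule root_paths_of)+
  interpret decomposition "root_paths_of T r" r G P
    using rp T(1) by (simp add: decomposition_def decomposition_axioms_def)
  have "last ` root_paths_of T r = verts T" using rp(2) verts_tree_of by metis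
  then have "\<exists>\<alpha> :: 'o rel. rank_in G \<alpha> (verts G)"
    using T(2,3) assms(2) by (intro ranks_bounded[OF ug]) (auto simp: rp(2))
  then show ?thesis by (simp add: has_normal_rank_def rank_in_def induce_verts[OF ug])
qed

unbundle no cardinal_syntax


section \<open>From ranks to tree-decompositions\<close>

lemma normally_spanned_UN:
  assumes G: "connected_ugraph G" and "finite I" "\<And>i. i \<in> I \<Longrightarrow> normally_spanned G (F i)"
  shows "normally_spanned G (\<Union>i\<in>I. F i)"
  using assms(2,3)
proof (induction I rule: finite_induct)
  case empty
  obtain r where "ugraph G" "r \<in> verts G" using G by (auto simp: connected_ugraph_def)
  from normal_paths_singleton[OF this] show ?case by (auto simp: normally_spanned_iff)
next
  case (insert i I)
  then show ?case using normally_spanned_Un[OF G, of "F i" "\<Union>i\<in>I. F i"] by simp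
qed

text \<open>Needed because nodes of the decomposition tree have type \<open>'t\<close>, whereas
  those of \<open>nest\<close> are vertex sets.\<close>

lemma (in root_paths) root_paths_map:
  assumes e: "inj e"
  shows "root_paths (map e ` A) (e r)"
proof
  show "[e r] \<in> map e ` A" using root by force
  show "p \<noteq> []" if "p \<in> map e ` A" for p using that nonempty by auto
  show "hd p = e r" if "p \<in> map e ` A" for p using that nonempty hd_root by (auto simp: hd_map)
  show "p \<in> map e ` A" if px: "p @ [x] \<in> map e ` A" "p \<noteq> []" for p x
  proof -
    obtain q where q: "q \<in> A" "map e q = p @ [x]" using px(1) by force
    then obtain q' y where q': "q = q' @ [y]" by (cases q rule: rev_cases) auto
    then have "p = map e q'" using q(2) by simp
    then show ?thesis using butlast_closed[of q' y] q(1) q' px(2) by auto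
  qed
  show "inj_on last (map e ` A)"
  proof (rule inj_onI)
    fix p q assume pq: "p \<in> map e ` A" "q \<in> map e ` A" "last p = last q"
    then obtain p' q' where p': "p' \<in> A" "q' \<in> A" "p = map e p'" "q = map e q'" by blast
    then have "e (last p') = e (last q')" using pq(3) nonempty by (simp add: last_map)
    then show "p = q" using last_eqD p' injD[OF e] by blast
  qed
qed

text \<open>Each descent shortens the root path, so a ray cannot descend forever; after an ascent, a
  descent would lead back to the vertex just left, against injectivity.\<close>

lemma (in root_paths) ray_ascends:
  assumes "ray (tree_of A) f"
  shows "\<exists>g. \<forall>i. g i \<in> A \<and> (\<exists>c. g (Suc i) = g i @ [c])"
proof -
  have f: "inj f" "\<And>n. f n \<in> last ` A" "\<And>n. adj (tree_of A) (f n) (f (Suc n))"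
    using assms by (auto simp: ray_def)
  then have "\<forall>n. \<exists>q. q \<in> A \<and> last q = f n" by (metis imageE)
  then obtain p where p: "\<And>n. p n \<in> A" "\<And>n. last (p n) = f n" by (metis (no_types))
  have adj: "(\<exists>c. p (Suc n) = p n @ [c]) \<or> (\<exists>c. p n = p (Suc n) @ [c])" for n
  proof -
    obtain q where q: "q \<in> A"
      "last q = f n \<and> q @ [f (Suc n)] \<in> A \<or> last q = f (Suc n) \<and> q @ [f n] \<in> A"
      using f(3)[of n] by (auto simp: adj_tree_of)
    from q(2) show ?thesis
    proof
      assume "last q = f n \<and> q @ [f (Suc n)] \<in> A"
      then have "q = p n" "q @ [f (Suc n)] = p (Suc n)"
        using last_eqD[OF q(1) p(1)[of n]] last_eqD[OF _ p(1)[of "Suc n"]] p(2) by auto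
      then show ?thesis by metis
    next
      assume "last q = f (Suc n) \<and> q @ [f n] \<in> A"
      then have "q = p (Suc n)" "q @ [f n] = p n"
        using last_eqD[OF q(1) p(1)[of "Suc n"]] last_eqD[OF _ p(1)[of n]] p(2) by auto
      then show ?thesis by metis
    qed
  qed
  have "\<exists>n c. p (Suc n) = p n @ [c]"
  proof (rule ccontr)
    assume no: "\<nexists>n c. p (Suc n) = p n @ [c]"
    then have down: "length (p n) = Suc (length (p (Suc n)))" for n
      using adj[of n] by auto
    have "length (p 0) = length (p n) + n" for n
    proof (induction n)
      case (Suc n)
      then show ?case using down[of n] by simp
    qed simp
    from this[of "Suc (length (p 0))"] show False by simp
  qed
  then obtain N c where N: "p (Suc N) = p N @ [c]" by blast
  have "\<exists>c. p (Suc (N + i)) = p (N + i) @ [c]" for i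
  proof (induction i)
    case 0
    then show ?case using N by simp
  next
    case (Suc i)
    then obtain c where c: "p (Suc (N + i)) = p (N + i) @ [c]" by blast
    have "p (N + i) \<noteq> p (Suc (Suc (N + i)))"
      using p(2)[of "N + i"] p(2)[of "Suc (Suc (N + i))"] injD[OF f(1), of "N + i" "Suc (Suc (N + i))"] by auto
    then show ?case using adj[of "Suc (N + i)"] c by auto
  qed
  then show ?thesis using p(1) by (intro exI[of _ "\<lambda>i. p (N + i)"]) auto
qed

inductive_set nest :: "'v ugraph \<Rightarrow> ('v set \<Rightarrow> 'v set) \<Rightarrow> 'v set list set" for G X where
  root: "[verts G] \<in> nest G X"
| child: "p \<in> nest G X \<Longrightarrow> C \<in> comps G (last p - X (last p)) \<Longrightarrow> p @ [C] \<in> nest G X"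

text \<open>
  Deleting \<open>X A\<close> from \<open>A\<close> and passing to components, over and over, yields a tree of vertex sets;
  it is rayless because \<open>R\<close> (the comparison of ranks) is well-founded.
\<close>

locale nested_components =
  fixes G :: "'v ugraph" and X :: "'v set \<Rightarrow> 'v set" and R :: "'v set rel" and good :: "'v set \<Rightarrow> bool"
  assumes conn: "connected_ugraph G"
    and good_root: "good (verts G)"
    and good_comps: "good A \<Longrightarrow> C \<in> comps G (A - X A) \<Longrightarrow> good C \<and> (C, A) \<in> R"
    and spanned: "good A \<Longrightarrow> normally_spanned G (X A)"
    and wf: "wf R" and trans: "trans R"
begin

abbreviation "N \<equiv> nest G X"

lemma graph: "ugraph G"
  using conn by (simp add: connected_ugraph_def)

lemma nest_props: "p \<in> N \<Longrightarrow> p \<noteq> [] \<and> hd p = verts G \<and> good (last p) \<and> last p \<noteq> {} \<and> last p \<subseteq> verts G"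
proof (induction rule: nest.induct)
  case root
  then show ?case using good_root conn by (simp add: connected_ugraph_def)
next
  case (child p C)
  then show ?case using good_comps comps_nonempty comps_subset by fastforce
qed

lemma nest_snocD:
  assumes "p @ [C] \<in> N" "p \<noteq> []"
  shows "p \<in> N" "C \<in> comps G (last p - X (last p))"
  using assms by (auto elim: nest.cases)

lemma nest_appendD:
  "p @ C # s \<in> N \<Longrightarrow> p \<noteq> [] \<Longrightarrow> p \<in> N \<and> C \<in> comps G (last p - X (last p)) \<and>
     last (C # s) \<subseteq> C \<and> (last (C # s), last p) \<in> R"
proof (induction s rule: rev_induct)
  case Nil
  then have "p \<in> N" "C \<in> comps G (last p - X (last p))" using nest_snocD[of p C] by simp_all
  then show ?case using good_comps nest_props by simp
next
  case (snoc D s)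
  then have D: "p @ C # s \<in> N" "D \<in> comps G (last (p @ C # s) - X (last (p @ C # s)))"
    using nest_snocD[of "p @ C # s" D] by simp_all
  note IH = snoc.IH[OF D(1) snoc.prems(2)]
  have l: "last (p @ C # s) = last (C # s)" by simp
  have "D \<subseteq> last (C # s)" using comps_subset[OF D(2)] unfolding l by blast
  moreover have "(D, last (C # s)) \<in> R" using good_comps[OF _ D(2)] nest_props[OF D(1)] unfolding l by blast
  ultimately show ?case using IH transD[OF trans] by (metis last_ConsR last_snoc snoc_eq_iff_butlast subset_trans)
qed

lemma nest_disjoint:
  assumes "p \<in> N" "q \<in> N" "p = m @ a" "q = m @ b" "m \<noteq> []" "a \<noteq> []" "b \<noteq> []" "hd a \<noteq> hd b"
  shows "last p \<inter> last q = {}"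
proof -
  obtain C s where a: "a = C # s" using assms(6) by (cases a) auto
  obtain D t where b: "b = D # t" using assms(7) by (cases b) auto
  have C: "C \<in> comps G (last m - X (last m))" "last p \<subseteq> C"
    using nest_appendD[of m C s] assms a by simp_all
  have D: "D \<in> comps G (last m - X (last m))" "last q \<subseteq> D"
    using nest_appendD[of m D t] assms b by simp_all
  have "C \<noteq> D" using assms(8) a b by simp
  then have "C \<inter> D = {}" using comps_disjoint[OF C(1) D(1)] by blast
  then show ?thesis using C(2) D(2) by blast
qed

sublocale nest: root_paths N "verts G"
proof
  show "[verts G] \<in> N" by (rule nest.root)
  show "p \<noteq> []" "hd p = verts G" if "p \<in> N" for p using nest_props[OF that] by auto
  show "p \<in> N" if "p @ [C] \<in> N" "p \<noteq> []" for p C by (rule nest_snocD[OF that])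
  show "inj_on last N"
  proof (rule inj_onI)
    fix p q assume pq: "p \<in> N" "q \<in> N" "last p = last q"
    obtain m a b where mab: "p = m @ a" "q = m @ b" "a = [] \<or> b = [] \<or> hd a \<noteq> hd b"
      by (rule list_meet)
    have hd: "p \<noteq> []" "q \<noteq> []" "hd p = hd q" using nest_props pq by metis+
    then have m: "m \<noteq> []" using mab by (cases m) auto
    \<comment> \<open>Along a branch \<open>R\<close> decreases strictly, so no vertex set repeats;
      sets on different branches are disjoint and non-empty.\<close>
    have strict: "last (m @ C # s) \<noteq> last m" if "m @ C # s \<in> N" for C s
      using nest_appendD[OF that m] wf_not_refl[OF wf] by (metis last_appendR list.discI)
    show "p = q"
    proof (cases "a = [] \<or> b = []")
      case True
      then show ?thesis using strict pq mab by (cases a; cases b) auto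
    next
      case False
      then have "last p \<inter> last q = {}" using nest_disjoint[OF pq(1,2) mab(1,2) m] mab(3) by blast
      then show ?thesis using pq nest_props by auto
    qed
  qed
qed

text \<open>\<open>X A\<close> may reach outside \<open>A\<close>. With the intersection, each
  vertex is deleted at exactly one node (\<open>vertex_node\<close>, \<open>node_unique\<close>), on
  which convexity of the parts rests.\<close>

definition covered :: "'v set list \<Rightarrow> 'v set" where
  "covered p = (\<Union>A\<in>set p. A \<inter> X A)"

lemma covered_prefix: "prefix p q \<Longrightarrow> covered p \<subseteq> covered q"
  by (auto simp: covered_def prefix_def)

lemma normally_spanned_covered:
  assumes "p \<in> N"
  shows "normally_spanned G (covered p)"
  unfolding covered_def
proof (rule normally_spanned_UN[OF conn])
  fix A assume "A \<in> set p"
  then obtain q where "q \<in> N" "last q = A" using nest.mem_path[OF assms] by metis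
  then show "normally_spanned G (A \<inter> X A)"
    using nest_props spanned normally_spanned_subset by (metis Int_lower2)
qed simp

text \<open>As long as \<open>v\<close> is not deleted it passes on to a component, and this
  decreases in the well-founded \<open>R\<close>.\<close>

lemma vertex_node:
  assumes "p \<in> N" "v \<in> last p"
  shows "\<exists>q\<in>N. prefix p q \<and> v \<in> last q \<inter> X (last q)"
  using wf assms
proof (induction "last p" arbitrary: p rule: wf_induct_rule)
  case less
  show ?case
  proof (cases "v \<in> X (last p)")
    case True
    then show ?thesis using less.prems by (intro bexI[of _ p]) auto
  next
    case False
    then obtain C where C: "C \<in> comps G (last p - X (last p))" "v \<in> C"
      using comps_cover less.prems(2) by (metis DiffI)
    have "(C, last p) \<in> R" using good_comps[OF _ C(1)] nest_props[OF less.prems(1)] by blast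
    moreover have "p @ [C] \<in> N" using less.prems(1) C(1) by (rule nest.child)
    ultimately obtain q where "q \<in> N" "prefix (p @ [C]) q" "v \<in> last q \<inter> X (last q)"
      using less.hyps[of "p @ [C]"] C(2) by auto
    then show ?thesis by (meson append_prefixD)
  qed
qed

text \<open>Adjacent vertices stay in the same component until one of them is deleted at some node.
  The other is deleted there or at a node above, and the set accumulated at the higher node contains
  both.\<close>

lemma edge_node:
  assumes "p \<in> N" "u \<in> last p" "v \<in> last p" "adj G u v"
  shows "\<exists>q\<in>N. u \<in> covered q \<and> v \<in> covered q"
  using wf assms
proof (induction "last p" arbitrary: p rule: wf_induct_rule)
  case less
  have node: "\<exists>q\<in>N. x \<in> covered q \<and> y \<in> covered q"
    if x: "x \<in> last p" "x \<in> X (last p)" and y: "y \<in> last p" for x y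
  proof -
    obtain q where q: "q \<in> N" "prefix p q" "y \<in> last q \<inter> X (last q)"
      using vertex_node[OF less.prems(1) y] by blast
    have "last p \<in> set p" "last q \<in> set q"
      using nest.nonempty less.prems(1) q(1) by simp_all
    then have "x \<in> covered p" "y \<in> covered q" using x q(3) unfolding covered_def by blast+
    then show ?thesis using covered_prefix[OF q(2)] q(1) by blast
  qed
  show ?case
  proof (cases "u \<in> X (last p) \<or> v \<in> X (last p)")
    case True
    then show ?thesis using node[of u v] node[of v u] less.prems by blast
  next
    case False
    then obtain C where C: "C \<in> comps G (last p - X (last p))" "u \<in> C"
      using comps_cover less.prems(2) by (metis DiffI)
    then have "v \<in> C" using comps_adj[OF C less.prems(4)] False less.prems(3) by blast
    moreover have "(C, last p) \<in> R" using good_comps[OF _ C(1)] nest_props[OF less.prems(1)] by blast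
    moreover have "p @ [C] \<in> N" using less.prems(1) C(1) by (rule nest.child)
    ultimately show ?thesis using less.hyps[of "p @ [C]"] C(2) less.prems(4) by simp
  qed
qed

text \<open>A vertex deleted at a node belongs to no set above it, and sets on different branches
  are disjoint.\<close>

lemma node_unique:
  assumes "p \<in> N" "q \<in> N" "v \<in> last p \<inter> X (last p)" "v \<in> last q \<inter> X (last q)"
  shows "p = q"
proof -
  obtain m a b where mab: "p = m @ a" "q = m @ b" "a = [] \<or> b = [] \<or> hd a \<noteq> hd b"
    by (rule list_meet)
  have hd: "p \<noteq> []" "q \<noteq> []" "hd p = hd q" using nest_props assms by metis+
  then have m: "m \<noteq> []" using mab by (cases m) auto
  have below: "v \<notin> X (last m)" if "m @ C # s \<in> N" "v \<in> last (m @ C # s)" for C s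
    using nest_appendD[OF that(1) m] that(2) comps_subset[of C G "last m - X (last m)"] by auto
  show ?thesis
  proof (cases "a = [] \<or> b = []")
    case True
    then show ?thesis using below assms mab by (cases a; cases b) auto
  next
    case False
    then have "last p \<inter> last q = {}" using nest_disjoint[OF assms(1,2) mab(1,2) m] mab(3) by blast
    then show ?thesis using assms by blast
  qed
qed

lemma node_of_covered:
  assumes "p \<in> N" "v \<in> covered p"
  shows "\<exists>k\<in>N. prefix k p \<and> v \<in> last k \<inter> X (last k) \<and> v \<in> covered k"
proof -
  obtain A where A: "A \<in> set p" "v \<in> A \<inter> X A" using assms(2) by (auto simp: covered_def)
  obtain k s where k: "p = k @ s" "k \<in> N" "last k = A" using nest.mem_path[OF assms(1) A(1)] .
  then have "A \<in> set k" using nest_props last_in_set by metis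
  then have "v \<in> covered k" using A(2) by (auto simp: covered_def)
  then show ?thesis using k A(2) by (intro bexI[of _ k]) auto
qed

section \<open>The decomposition tree with its nodes moved to \<open>'t\<close>\<close>

context
  fixes e :: "'v set \<Rightarrow> 't"
  assumes e: "inj e"
begin

text \<open>For a node \<open>t\<close> the union has a single member, see \<open>part_eq\<close>;
  every other \<open>t\<close> gets the empty set.\<close>

definition part :: "'t \<Rightarrow> 'v set" where
  "part t = (\<Union>p\<in>{p\<in>N. e (last p) = t}. covered p)"

lemma part_eq: "p \<in> N \<Longrightarrow> part (e (last p)) = covered p"
  using injD[OF e] nest.last_eqD by (fastforce simp: part_def)

lemma verts_image: "verts (tree_of (map e ` N)) = (\<lambda>p. e (last p)) ` N"
  using nest.nonempty by (auto simp: image_image last_map intro!: image_cong)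

interpretation image: root_paths "map e ` N" "e (verts G)"
  by (rule nest.root_paths_map[OF e])

lemma no_ray: "\<not> ray (tree_of (map e ` N)) f"
proof
  assume "ray (tree_of (map e ` N)) f"
  then obtain g where g: "\<And>i. g i \<in> map e ` N" "\<And>i. \<exists>c. g (Suc i) = g i @ [c]"
    using image.ray_ascends by blast
  then have "\<forall>i. \<exists>q. q \<in> N \<and> g i = map e q" by (metis imageE)
  then obtain h where h: "\<And>i. h i \<in> N" "\<And>i. g i = map e (h i)" by (metis (no_types))
  have "(last (h (Suc i)), last (h i)) \<in> R" for i
  proof -
    obtain c where c: "map e (h (Suc i)) = map e (h i) @ [c]" using g(2)[of i] h(2) by auto
    then obtain q x where q: "h (Suc i) = q @ [x]" by (cases "h (Suc i)" rule: rev_cases) auto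
    then have "map e q = map e (h i)" using c by simp
    then have "q = h i" using e by (simp add: inj_map_eq_map)
    then show ?thesis
      using nest_appendD[of "h i" x "[]"] h(1)[of "Suc i"] nest.nonempty[OF h(1)[of i]] q by simp
  qed
  then have "\<exists>f. \<forall>i. (f (Suc i), f i) \<in> R" by (intro exI[of _ "\<lambda>i. last (h i)"] allI)
  then show False using wf unfolding wf_iff_no_infinite_down_chain by (rule notE[rotated])
qed

text \<open>The parts containing \<open>v\<close> are those at the nodes above the unique node
  \<open>k\<close> where \<open>v\<close> is deleted. If \<open>p\<close> and \<open>q\<close> are
  above \<open>k\<close>, so is their meet \<open>m\<close>, and hence so is every node on the tree
  path through \<open>m\<close>.\<close>

lemma part_convex:
  assumes ps: "upath_between (tree_of (map e ` N)) t1 ps t3" and t2: "t2 \<in> set ps"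
  shows "part t1 \<inter> part t3 \<subseteq> part t2"
proof
  fix v assume v: "v \<in> part t1 \<inter> part t3"
  then obtain p q where p: "p \<in> N" "t1 = e (last p)" "v \<in> covered p"
    and q: "q \<in> N" "t3 = e (last q)" "v \<in> covered q"
    by (auto simp: part_def)
  obtain k where k: "k \<in> N" "prefix k p" "v \<in> last k \<inter> X (last k)" "v \<in> covered k"
    using node_of_covered[OF p(1,3)] by blast
  obtain k' where k': "k' \<in> N" "prefix k' q" "v \<in> last k' \<inter> X (last k')"
    using node_of_covered[OF q(1,3)] by blast
  have kq: "prefix k q" using node_unique[OF k(1) k'(1) k(3) k'(3)] k'(2) by simp
  obtain m a b where mab: "p = m @ a" "q = m @ b" "a = [] \<or> b = [] \<or> hd a \<noteq> hd b"
    by (rule list_meet)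
  have hd: "p \<noteq> []" "q \<noteq> []" "hd p = hd q" using nest_props p q by metis+
  then have m: "m \<noteq> []" using mab by (cases m) auto
  have km: "prefix k m"
  proof (rule ccontr)
    assume "\<not> prefix k m"
    then obtain z s where z: "k = m @ z # s"
      using prefix_same_cases[of k p m] k(2) mab(1)
      by (metis append.right_neutral list.exhaust prefixI prefix_def)
    then show False using k(2) kq mab by (auto simp: prefix_def)
  qed
  have "upath_between (tree_of (map e ` N)) (last (map e m @ map e a))
      (rev (map e a) @ last (map e m) # map e b) (last (map e m @ map e b))"
  proof (rule image.meet_path)
    show "map e m \<noteq> []" using m by simp
    show "map e m @ map e a \<in> map e ` N" "map e m @ map e b \<in> map e ` N"
      using p(1) q(1) mab by (metis imageI map_append)+
    show "map e a = [] \<or> map e b = [] \<or> hd (map e a) \<noteq> hd (map e b)"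
      using mab(3) by (auto simp: hd_map inj_eq[OF e])
  qed
  moreover have "last (map e m @ map e a) = t1" "last (map e m @ map e b) = t3"
    using p(2) q(2) mab hd by (metis last_map map_append)+
  ultimately have "ps = rev (map e a) @ last (map e m) # map e b"
    using ps image.no_cycle unfolding upath_between_def by (intro upath_unique) auto
  then have "t2 \<in> e ` set a \<or> t2 = e (last m) \<or> t2 \<in> e ` set b"
    using t2 m by (auto simp: last_map)
  moreover have above: "v \<in> part (e (last l))" if "l \<in> N" "prefix m l" for l
  proof -
    have "prefix k l" using km that(2) by (rule prefix_order.trans)
    then show ?thesis using part_eq[OF that(1)] covered_prefix k(4) by blast
  qed
  moreover have below: "v \<in> part (e x)" if x: "x \<in> set c" "m @ c \<in> N" for x c
  proof -
    obtain c1 c2 where "c = c1 @ x # c2" using x(1) by (meson split_list)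
    then have "m @ c1 @ [x] \<in> N" using nest.prefix_closed[of "m @ c1 @ [x]" c2] x(2) by simp
    from above[OF this] show ?thesis by simp
  qed
  moreover have "v \<in> part (e (last m))"
    using above[of m] nest.prefix_closed[of m a] p(1) mab(1) m by simp
  ultimately show "v \<in> part t2"
    using below[of _ a] below[of _ b] p(1) q(1) mab(1,2) by blast
qed

lemma decomposition: "tree_decomposition G (tree_of (map e ` N)) part"
proof -
  let ?T = "tree_of (map e ` N)"
  have in_part: "(\<exists>t\<in>verts ?T. S \<subseteq> part t) \<longleftrightarrow> (\<exists>p\<in>N. S \<subseteq> covered p)" for S
    unfolding verts_image using part_eq by auto
  have "(\<Union>t\<in>verts ?T. part t) = (\<Union>p\<in>N. covered p)"
    unfolding verts_image using part_eq by auto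
  also have "\<dots> = verts G"
  proof
    show "(\<Union>p\<in>N. covered p) \<subseteq> verts G"
      using normally_spanned_covered by (auto simp: normally_spanned_def)
    show "verts G \<subseteq> (\<Union>p\<in>N. covered p)"
    proof
      fix v assume "v \<in> verts G"
      then obtain q where q: "q \<in> N" "v \<in> last q \<inter> X (last q)"
        using vertex_node[OF nest.root, of v] by auto
      have "last q \<in> set q" using nest.nonempty[OF q(1)] by simp
      then have "v \<in> covered q" unfolding covered_def using q(2) by blast
      then show "v \<in> (\<Union>p\<in>N. covered p)" using q(1) by blast
    qed
  qed
  finally have cover: "(\<Union>t\<in>verts ?T. part t) = verts G" .
  have edges: "\<exists>t\<in>verts ?T. E \<subseteq> part t" if E: "E \<in> edges G" for E
  proof -
    obtain u v where uv: "u \<in> verts G" "v \<in> verts G" "E = {u, v}"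
      using graph E by (auto simp: ugraph_def)
    then have "adj G u v" using E by (simp add: adj_def)
    then show ?thesis
      using edge_node[OF nest.root, of u v] uv unfolding in_part by auto
  qed
  show ?thesis
    unfolding tree_decomposition_def
    by (intro conjI ballI allI impI image.utree_tree_of cover edges part_convex)
qed

lemma traceable: "normally_traceable TYPE('t) G"
  unfolding normally_traceable_def
proof (intro conjI conn exI)
  show "tree_decomposition G (tree_of (map e ` N)) part" by (rule decomposition)
  show "\<nexists>f. ray (tree_of (map e ` N)) f" using no_ray by blast
  show "\<forall>t\<in>verts (tree_of (map e ` N)). normally_spanned G (part t)"
    unfolding verts_image using part_eq normally_spanned_covered by auto
qed

end

end

unbundle cardinal_syntax

lemma traceable_if_normal_rank:
  fixes G :: "'v ugraph" and e :: "'v set \<Rightarrow> 't"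
  assumes G: "connected_ugraph G" and rank: "has_normal_rank TYPE('o) G" and e: "inj e"
  shows "normally_traceable TYPE('t) G"
proof -
  have ug: "ugraph G" using G by (simp add: connected_ugraph_def)
  define good where "good A \<longleftrightarrow> (\<exists>\<alpha> :: 'o rel. rank_in G \<alpha> A)" for A
  define rk where "rk A = (SOME \<alpha> :: 'o rel. rank_in G \<alpha> A)" for A
  have rk: "rank_in G (rk A) A" if "good A" for A
    using that unfolding good_def rk_def by (rule someI_ex)
  define R where "R = inv_image (ordLess :: ('o rel \<times> 'o rel) set) rk"
  have "\<exists>X. normally_spanned G X \<and> (\<forall>C\<in>comps G (A - X). good C \<and> (C, A) \<in> R)" if A: "good A" for A
  proof -
    obtain X where X: "normally_spanned G X"
      "\<And>C. C \<in> comps G (A - X) \<Longrightarrow> \<exists>\<beta> :: 'o rel. \<beta> <o rk A \<and> rank_in G \<beta> C"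
      using rank_in_step[OF ug rk[OF A]] by blast
    have "good C \<and> (C, A) \<in> R" if C: "C \<in> comps G (A - X)" for C
    proof -
      obtain \<beta> :: "'o rel" where \<beta>: "\<beta> <o rk A" "rank_in G \<beta> C" using X(2)[OF C] by blast
      then have g: "good C" by (auto simp: good_def)
      \<comment> \<open>The recursion only yields some rank \<open>\<beta>\<close> of
        \<open>C\<close> below \<open>rk A\<close>; uniqueness of ranks carries the decrease over to
        the chosen rank.\<close>
      then have "rk C \<le>o \<beta>" using rank_in_ordLeq[OF ug rk[OF g] \<beta>(2)] by simp
      then have "rk C <o rk A" using \<beta>(1) ordLeq_ordLess_trans by blast
      then show ?thesis using g by (simp add: R_def)
    qed
    then show ?thesis using X(1) by blast
  qed
  then obtain X where X: "\<And>A. good A \<Longrightarrow> normally_spanned G (X A)"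
    "\<And>A C. good A \<Longrightarrow> C \<in> comps G (A - X A) \<Longrightarrow> good C \<and> (C, A) \<in> R"
    by metis
  have "good (verts G)"
    using rank by (simp add: good_def has_normal_rank_def rank_in_def induce_verts[OF ug])
  moreover have "wf R" unfolding R_def by (intro wf_inv_image wf_ordLess)
  moreover have "trans R"
    unfolding R_def by (intro trans_inv_image transI) (rule ordLess_transitive)
  ultimately interpret nested_components G X R good
    using G X by unfold_locales auto
  show ?thesis by (rule traceable[OF e])
qed

unbundle no cardinal_syntax


section \<open>Normal traceability and normal rank\<close>

theorem theorem3:
  fixes G :: "'v ugraph"
    and emb_t :: "'v set \<Rightarrow> 't"
    and emb_o :: "'v set \<Rightarrow> 'o"
  assumes "connected_ugraph G"
    and "inj emb_t"
    and "inj emb_o"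
  shows "normally_traceable TYPE('t) G \<longleftrightarrow> has_normal_rank TYPE('o) G"
  using normal_rank_if_traceable[of G emb_o] traceable_if_normal_rank[of G emb_t] assms by blast

end
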